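(* For all integers $n\ge0$ and $k\ge1$, \[ \dim_{\mathbb{Q}}\bar{\rho}_n(\check{\mathfrak{H}}_k^1)=\dim_{\mathbb{Q}}\rho_n(\check{\mathfrak{H}}_k^1) =\frac{1}{n+k}\sum_{m\mid n+k}\varphi\Bigl(\frac{n+k}{m}\Bigr)\bigl(2^m-L_m^n\bigr)-2, \] where the sum runs over the positive divisors $m$ of $n+k$ and $\varphi$ is Euler's totient function.
   Context: Let $\mathfrak{H}=\mathbb{Q}\langle x,y\rangle$ be the noncommutative polynomial algebra over $\mathbb{Q}$ in $x,y$; put $z=x+y$ and $z_k=x^{k-1}y$ for $k\ge1$. For $k\ge1$, $\check{\mathfrak{H}}_k^1$ is the $\mathbb{Q}$-span of all monomials $z_{k_1}\cdots z_{k_l}$ with $l\ge1$, $k_i\ge1$, $k_1+\dots+k_l=k$, not all $k_i=1$. For $n\ge0$, make $\mathfrak{H}^{\otimes(n+2)}$ an $\mathfrak{H}$-bimodule via $a\diamond(w_1\otimes\cdots\otimes w_{n+2})\diamond b=w_1b\otimes w_2\otimes\cdots\otimes w_{n+1}\otimes aw_{n+2}$. Let $M_n(w_1\otimes\cdots\otimes w_{n+2})=w_1\cdots w_{n+2}$. Let $\mathcal{C}_n\colon\mathfrak{H}\to\mathfrak{H}^{\otimes(n+2)}$ be the $\mathbb{Q}$-linear map with $\mathcal{C}_n(1)=0$, $\mathcal{C}_n(x)=x\otimes z^{\otimes n}\otimes y$, $\mathcal{C}_n(y)=-x\otimes z^{\otimes n}\otimes y$, $\mathcal{C}_n(ww')=\mathcal{C}_n(w)\diamond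 w'+w\diamond\mathcal{C}_n(w')$, and $\rho_n=M_n\circ\mathcal{C}_n$. Let $\gamma$ be the algebra automorphism of $\mathfrak{H}$ with $\gamma(x)=x$, $\gamma(y)=z$. Let $\bar{\mathcal{C}}_n\colon\mathfrak{H}\to\mathfrak{H}^{\otimes(n+2)}$ be the $\mathbb{Q}$-linear map with $\bar{\mathcal{C}}_n(1)=0$, $\bar{\mathcal{C}}_n(x)=x\otimes y^{\otimes(n+1)}$, $\bar{\mathcal{C}}_n(y)=-x\otimes y^{\otimes(n+1)}$, $\bar{\mathcal{C}}_n(ww')=\bar{\mathcal{C}}_n(w)\diamond\gamma^{-1}(w')+\gamma^{-1}(w)\diamond\bar{\mathcal{C}}_n(w')$, and $\bar{\rho}_n=M_n\circ\bar{\mathcal{C}}_n$. For $n\ge1$, the $n$-step Lucas sequence is $L_m^n=2^m-1$ for $m=1,\dots,n$ and $L_m^n=L_{m-1}^n+\cdots+L_{m-n}^n$ for $m\ge n+1$; by convention $L_m^0=0$ for all $m\ge1$. *)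

theory Defs
  imports Complex_Main "HOL-Library.Poly_Mapping" "HOL-Number_Theory.Totient"
begin

text \<open>The type \<open>'a \<Rightarrow>\<^sub>0 rat\<close> is the rational vector space with basis \<open>'a\<close>.\<close>

definition scale :: "rat \<Rightarrow> ('a \<Rightarrow>\<^sub>0 rat) \<Rightarrow> ('a \<Rightarrow>\<^sub>0 rat)"
  where "scale c p = Poly_Mapping.map ((*) c) p"

lemma lookup_scale [simp]: "Poly_Mapping.lookup (scale c p) u = c * Poly_Mapping.lookup p u"
  by (simp add: scale_def Poly_Mapping.map.rep_eq when_def)

global_interpretation qvs: vector_space "scale :: rat \<Rightarrow> ('a \<Rightarrow>\<^sub>0 rat) \<Rightarrow> ('a \<Rightarrow>\<^sub>0 rat)"
  by unfold_locales (auto intro!: poly_mapping_eqI simp: lookup_add algebra_simps)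

abbreviation qlinear :: "(('a \<Rightarrow>\<^sub>0 rat) \<Rightarrow> ('b \<Rightarrow>\<^sub>0 rat)) \<Rightarrow> bool"
  where "qlinear \<equiv> Vector_Spaces.linear scale scale"

abbreviation monom :: "'a \<Rightarrow> ('a \<Rightarrow>\<^sub>0 rat)"
  where "monom u \<equiv> Poly_Mapping.single u 1"

definition lin_ext :: "('a \<Rightarrow> ('b \<Rightarrow>\<^sub>0 rat)) \<Rightarrow> ('a \<Rightarrow>\<^sub>0 rat) \<Rightarrow> ('b \<Rightarrow>\<^sub>0 rat)"
  where "lin_ext f p = (\<Sum>u\<in>Poly_Mapping.keys p. scale (Poly_Mapping.lookup p u) (f u))"

lemma qlinearI:
  assumes "\<And>p q. f (p + q) = f p + f q" "\<And>c p. f (scale c p) = scale c (f p)"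
  shows "qlinear f"
  by (rule Vector_Spaces.linear.intro[OF qvs.vector_space_axioms qvs.vector_space_axioms])
    (unfold_locales, use assms in auto)

lemma qlinear_add: "qlinear f \<Longrightarrow> f (p + q) = f p + f q"
  by (simp add: Vector_Spaces.linear_iff)

lemma qlinear_scale: "qlinear f \<Longrightarrow> f (scale c p) = scale c (f p)"
  by (simp add: Vector_Spaces.linear_iff)

lemma lin_ext_superset:
  assumes "finite A" "Poly_Mapping.keys p \<subseteq> A"
  shows "lin_ext f p = (\<Sum>u\<in>A. scale (Poly_Mapping.lookup p u) (f u))"
  unfolding lin_ext_def
  by (rule sum.mono_neutral_left) (use assms in \<open>auto simp: in_keys_iff\<close>)

lemma lin_ext_add: "lin_ext f (p + q) = lin_ext f p + lin_ext f q"
proof -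
  let ?A = "Poly_Mapping.keys p \<union> Poly_Mapping.keys q"
  have "lin_ext f (p + q) = (\<Sum>u\<in>?A. scale (Poly_Mapping.lookup (p + q) u) (f u))"
    by (rule lin_ext_superset) (auto simp: Poly_Mapping.keys_add)
  moreover have "lin_ext f p = (\<Sum>u\<in>?A. scale (Poly_Mapping.lookup p u) (f u))"
    by (rule lin_ext_superset) auto
  moreover have "lin_ext f q = (\<Sum>u\<in>?A. scale (Poly_Mapping.lookup q u) (f u))"
    by (rule lin_ext_superset) auto
  ultimately show ?thesis
    by (simp add: lookup_add qvs.scale_left_distrib sum.distrib)
qed

lemma lin_ext_scale: "lin_ext f (scale c p) = scale c (lin_ext f p)"
proof -
  have "lin_ext f (scale c p)
      = (\<Sum>u\<in>Poly_Mapping.keys p. scale (Poly_Mapping.lookup (scale c p) u) (f u))"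
    by (rule lin_ext_superset) (auto simp: in_keys_iff)
  then show ?thesis
    by (simp add: lin_ext_def qvs.scale_sum_right)
qed

lemma qlinear_lin_ext [intro, simp]: "qlinear (lin_ext f)"
  by (intro qlinearI lin_ext_add lin_ext_scale)

lemma lin_ext_monom [simp]: "lin_ext f (monom u) = f u"
  by (simp add: lin_ext_def)

lemma lin_ext_monom_id: "lin_ext monom p = p"
proof (rule poly_mapping_eqI)
  fix u
  have "Poly_Mapping.lookup (lin_ext monom p) u =
     (\<Sum>v\<in>Poly_Mapping.keys p. Poly_Mapping.lookup p v * (if v = u then 1 else 0))"
    by (simp add: lin_ext_def lookup_sum lookup_single when_def)
  also have "\<dots> = (\<Sum>v\<in>Poly_Mapping.keys p. if v = u then Poly_Mapping.lookup p v else 0)"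
    by (intro sum.cong) auto
  also have "\<dots> = Poly_Mapping.lookup p u"
    by (simp add: in_keys_iff)
  finally show "Poly_Mapping.lookup (lin_ext monom p) u = Poly_Mapping.lookup p u" .
qed

lemma qlinear_zero: "qlinear f \<Longrightarrow> f 0 = 0"
  using qlinear_scale[of f 0 0] by simp

lemma qlinear_sum: "qlinear f \<Longrightarrow> f (sum g A) = (\<Sum>a\<in>A. f (g a))"
  by (induction A rule: infinite_finite_induct) (simp_all add: qlinear_zero qlinear_add)

lemma qlinear_expand:
  assumes "qlinear f" shows "f p = lin_ext (\<lambda>u. f (monom u)) p"
proof -
  have "f p = f (lin_ext monom p)" by (simp add: lin_ext_monom_id)
  also have "\<dots> = lin_ext (\<lambda>u. f (monom u)) p"
    using assms by (simp add: lin_ext_def qlinear_sum qlinear_scale)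
  finally show ?thesis .
qed

lemma qlinear_eqI:
  assumes "qlinear f" "qlinear g" "\<And>u. f (monom u) = g (monom u)"
  shows "f p = g p"
  using qlinear_expand[OF assms(1), of p] qlinear_expand[OF assms(2), of p] assms(3) by simp

lemma qlinear_compose: "qlinear f \<Longrightarrow> qlinear g \<Longrightarrow> qlinear (\<lambda>p. f (g p))"
  by (intro qlinearI) (simp_all add: qlinear_add qlinear_scale)

lemma qlinear_plus: "qlinear f \<Longrightarrow> qlinear g \<Longrightarrow> qlinear (\<lambda>p. f p + g p)"
  by (intro qlinearI) (simp_all add: qlinear_add qlinear_scale qvs.scale_right_distrib add_ac)

lemma qlinear_id: "qlinear (\<lambda>p. p)"
  by (intro qlinearI) simp_all

lemma qlinear_lin_ext_fun:
  assumes "\<And>u. qlinear (\<lambda>p. f p u)"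
  shows "qlinear (\<lambda>p. lin_ext (f p) q)"
proof (intro qlinearI)
  show "lin_ext (f (p + p')) q = lin_ext (f p) q + lin_ext (f p') q" for p p'
    by (simp add: lin_ext_def qlinear_add[OF assms] qvs.scale_right_distrib sum.distrib)
  show "lin_ext (f (scale c p)) q = scale c (lin_ext (f p) q)" for c p
    by (simp add: lin_ext_def qlinear_scale[OF assms] qvs.scale_sum_right mult.commute)
qed

text \<open>
  Lists form a monoid under concatenation, so the convolution product of
  \<^theory>\<open>HOL-Library.Poly_Mapping\<close> turns \<open>'a list \<Rightarrow>\<^sub>0 rat\<close> into the free associative
  unital algebra on \<open>'a\<close>.
\<close>

instantiation list :: (type) monoid_add
begin
definition zero_list :: "'a list" where "zero_list = []"
definition plus_list :: "'a list \<Rightarrow> 'a list \<Rightarrow> 'a list" where "plus_list = append"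
instance by standard (simp_all add: zero_list_def plus_list_def)
end

datatype letter = Lx | Ly

type_synonym ncpoly = "letter list \<Rightarrow>\<^sub>0 rat"

definition X :: ncpoly where "X = monom [Lx]"
definition Y :: ncpoly where "Y = monom [Ly]"
definition Z :: ncpoly where "Z = X + Y"

definition zmon :: "nat \<Rightarrow> ncpoly"
  where "zmon k = X ^ (k - 1) * Y"

definition H1_check :: "nat \<Rightarrow> ncpoly set"
  where "H1_check k = qvs.span {prod_list (map zmon ks) | ks.
      length ks \<ge> 1 \<and> (\<forall>i\<in>set ks. i \<ge> 1) \<and> sum_list ks = k \<and> \<not> (\<forall>i\<in>set ks. i = 1)}"

lemma monom_mult: "monom u * monom v = monom (u @ v)" for u v :: "'a list"
  by (simp add: mult_single plus_list_def)

lemma one_monom: "(1 :: 'a list \<Rightarrow>\<^sub>0 rat) = monom []"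
  by (simp add: zero_list_def flip: single_one)

lemma scale_conv_mult: "scale c p = Poly_Mapping.single 0 c * p"
  for p :: "'a::monoid_add \<Rightarrow>\<^sub>0 rat"
  by (simp add: scale_def mult_map_scale_conv_mult)

lemma scale_mult_left: "scale c p * q = scale c (p * q)" for p :: "'a::monoid_add \<Rightarrow>\<^sub>0 rat"
  by (simp add: scale_conv_mult mult.assoc)

lemma scale_monom: "scale c (monom u) = Poly_Mapping.single u c"
  by (rule poly_mapping_eqI) (simp add: lookup_single when_def)

lemma qlinear_mult_left: "qlinear (\<lambda>p. p * q)" for q :: "'a::monoid_add \<Rightarrow>\<^sub>0 rat"
  by (intro qlinearI) (simp_all add: distrib_right scale_mult_left)

lemma scalar_central: "Poly_Mapping.single 0 c * p = p * Poly_Mapping.single 0 c"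
  for p :: "'a::monoid_add \<Rightarrow>\<^sub>0 rat"
proof (rule qlinear_eqI[of "\<lambda>p. Poly_Mapping.single 0 c * p" "\<lambda>p. p * Poly_Mapping.single 0 c"])
  show "qlinear (\<lambda>p :: 'a \<Rightarrow>\<^sub>0 rat. Poly_Mapping.single 0 c * p)"
    by (intro qlinearI)
      (simp_all add: distrib_left mult.commute flip: scale_conv_mult)
qed (simp_all add: qlinear_mult_left mult_single)

lemma scale_mult_right: "p * scale c q = scale c (p * q)" for p :: "'a::monoid_add \<Rightarrow>\<^sub>0 rat"
  by (metis scale_conv_mult scalar_central mult.assoc)

lemma qlinear_mult_right: "qlinear (\<lambda>p. q * p)" for q :: "'a::monoid_add \<Rightarrow>\<^sub>0 rat"
  by (intro qlinearI) (simp_all add: distrib_left scale_mult_right)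

lemma bilinear_eqI:
  assumes "\<And>q. qlinear (\<lambda>p. f p q)" "\<And>p. qlinear (\<lambda>q. f p q)"
    and "\<And>q. qlinear (\<lambda>p. g p q)" "\<And>p. qlinear (\<lambda>q. g p q)"
    and "\<And>u v. f (monom u) (monom v) = g (monom u) (monom v)"
  shows "f p q = g p q"
proof -
  have "f (monom u) q = g (monom u) q" for u
    by (rule qlinear_eqI[OF assms(2,4,5)])
  then show ?thesis
    by (rule qlinear_eqI[OF assms(1,3)])
qed

definition alg_hom :: "(ncpoly \<Rightarrow> ncpoly) \<Rightarrow> bool"
  where "alg_hom g \<longleftrightarrow> qlinear g \<and> g 1 = 1 \<and> (\<forall>p q. g (p * q) = g p * g q)"

definition subst_hom :: "ncpoly \<Rightarrow> ncpoly \<Rightarrow> ncpoly \<Rightarrow> ncpoly"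
  where "subst_hom a b =
    lin_ext (\<lambda>w. prod_list (map (\<lambda>l. case l of Lx \<Rightarrow> a | Ly \<Rightarrow> b) w))"

definition gamma :: "ncpoly \<Rightarrow> ncpoly"
  where "gamma = subst_hom X Z"

lemma alg_hom_subst: "alg_hom (subst_hom a b)"
proof -
  have "subst_hom a b (p * q) = subst_hom a b p * subst_hom a b q" for p q
  proof (rule bilinear_eqI[of "\<lambda>p q. subst_hom a b (p * q)"
        "\<lambda>p q. subst_hom a b p * subst_hom a b q"])
    have l: "qlinear (subst_hom a b)" by (simp add: subst_hom_def)
    note c = qlinear_compose[OF l]
    note c1 = qlinear_compose[OF _ l]
    show "qlinear (\<lambda>p. subst_hom a b (p * q))" for q by (rule c[OF qlinear_mult_left])
    show "qlinear (\<lambda>p. subst_hom a b (q * p))" for q by (rule c[OF qlinear_mult_right])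
    show "qlinear (\<lambda>p. subst_hom a b p * subst_hom a b q)" for q
      by (rule c1[OF qlinear_mult_left])
    show "qlinear (\<lambda>p. subst_hom a b q * subst_hom a b p)" for q
      by (rule c1[OF qlinear_mult_right])
  qed (simp add: subst_hom_def monom_mult)
  then show ?thesis by (simp add: alg_hom_def subst_hom_def one_monom)
qed

lemma subst_hom_gens: "subst_hom a b X = a" "subst_hom a b Y = b"
  by (simp_all add: subst_hom_def X_def Y_def)

lemma monom_Cons: "monom (l # w) = (case l of Lx \<Rightarrow> X | Ly \<Rightarrow> Y) * monom w"
  by (cases l) (simp_all add: X_def Y_def monom_mult)

lemma alg_hom_eqI:
  assumes "alg_hom f" "alg_hom g" "f X = g X" "f Y = g Y"
  shows "f p = g p"
proof (rule qlinear_eqI[of f g])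
  show "qlinear f" "qlinear g" using assms by (simp_all add: alg_hom_def)
  show "f (monom w) = g (monom w)" for w
  proof (induction w)
    case Nil
    then show ?case using assms by (simp add: alg_hom_def flip: one_monom)
  next
    case (Cons l w)
    then show ?case using assms by (cases l) (simp_all add: monom_Cons alg_hom_def)
  qed
qed

lemma alg_hom_compose: "alg_hom f \<Longrightarrow> alg_hom g \<Longrightarrow> alg_hom (\<lambda>p. f (g p))"
  by (simp add: alg_hom_def qlinear_compose)

lemma alg_hom_id: "alg_hom (\<lambda>p. p)"
  by (simp add: alg_hom_def qlinear_id)

lemma alg_hom_gamma: "alg_hom gamma"
  by (simp add: gamma_def alg_hom_subst)

lemma gamma_gens: "gamma X = X" "gamma Y = Z"
  by (simp_all add: gamma_def subst_hom_gens)

lemma alg_hom_diff: "alg_hom f \<Longrightarrow> f (p - q) = f p - f q"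
  using qlinear_add[of f "p - q" q] by (simp add: alg_hom_def)

lemma gamma_subst: "gamma (subst_hom X (Y - X) p) = p" "subst_hom X (Y - X) (gamma p) = p"
proof -
  let ?d = "subst_hom X (Y - X)"
  show "gamma (?d p) = p"
    by (rule alg_hom_eqI[OF alg_hom_compose[OF alg_hom_gamma alg_hom_subst] alg_hom_id])
      (simp_all add: subst_hom_gens gamma_gens alg_hom_diff[OF alg_hom_gamma], simp add: Z_def)
  have "?d Z = Y"
    unfolding Z_def using alg_hom_subst[of X "Y - X"]
    by (subst qlinear_add) (simp_all add: alg_hom_def subst_hom_gens)
  with alg_hom_eqI[OF alg_hom_compose[OF alg_hom_subst alg_hom_gamma] alg_hom_id]
  show "?d (gamma p) = p"
    by (simp add: subst_hom_gens gamma_gens)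
qed

lemma bij_gamma: "bij gamma"
  by (rule o_bij[of "subst_hom X (Y - X)"]) (simp_all add: fun_eq_iff gamma_subst)

lemma inv_gamma: "inv gamma = subst_hom X (Y - X)"
  by (rule inv_unique_comp) (simp_all add: fun_eq_iff gamma_subst)

text \<open>
  The tensor algebra of \<^typ>\<open>ncpoly\<close> has as basis the finite sequences of words; its product,
  again given by concatenation of basis elements, is the tensor product. The \<open>m\<close>-th tensor power
  is the component of degree \<open>m\<close>.
\<close>

type_synonym tensor = "letter list list \<Rightarrow>\<^sub>0 rat"

definition tensor_power :: "nat \<Rightarrow> tensor set"
  where "tensor_power m = {t. \<forall>us\<in>Poly_Mapping.keys t. length us = m}"

definition emb :: "ncpoly \<Rightarrow> tensor"
  where "emb = lin_ext (\<lambda>u. monom [u])"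

definition pure_tensor :: "ncpoly list \<Rightarrow> tensor"
  where "pure_tensor ws = prod_list (map emb ws)"

text \<open>
  The actions are defined on basis elements and extended bilinearly;
  \<open>lact_pure\<close> and \<open>ract_pure\<close> below give their values on pure tensors.
\<close>

definition lact_words :: "letter list \<Rightarrow> letter list list \<Rightarrow> letter list list"
  where "lact_words a us = (if us = [] then [] else butlast us @ [a @ last us])"

definition ract_words :: "letter list list \<Rightarrow> letter list \<Rightarrow> letter list list"
  where "ract_words us b = (case us of [] \<Rightarrow> [] | u # us' \<Rightarrow> (u @ b) # us')"

definition lact :: "ncpoly \<Rightarrow> tensor \<Rightarrow> tensor"
  where "lact a t = lin_ext (\<lambda>u. lin_ext (\<lambda>us. monom (lact_words u us)) t) a"

definition ract :: "tensor \<Rightarrow> ncpoly \<Rightarrow> tensor"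
  where "ract t b = lin_ext (\<lambda>u. lin_ext (\<lambda>us. monom (ract_words us u)) t) b"

text \<open>On the tensor power of degree \<open>n + 2\<close> this is the map \<open>M\<^sub>n\<close>; see \<open>mult_tensor_pure\<close>.\<close>

definition mult_tensor :: "tensor \<Rightarrow> ncpoly"
  where "mult_tensor = lin_ext (\<lambda>us. monom (concat us))"

lemma qlinear_lact: "qlinear (\<lambda>a. lact a t)" "qlinear (lact a)"
  unfolding lact_def by (auto intro!: qlinear_lin_ext_fun)

lemma qlinear_ract: "qlinear (\<lambda>t. ract t b)" "qlinear (ract t)"
  unfolding ract_def by (auto intro!: qlinear_lin_ext_fun)

lemma lact_monom: "lact (monom u) (monom us) = monom (lact_words u us)"
  by (simp add: lact_def)

lemma ract_monom: "ract (monom us) (monom u) = monom (ract_words us u)"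
  by (simp add: ract_def)

lemma lact_lact: "lact a (lact b t) = lact (a * b) t"
proof (rule bilinear_eqI[of "\<lambda>a b. lact a (lact b t)" "\<lambda>a b. lact (a * b) t"])
  fix u v
  show "lact (monom u) (lact (monom v) t) = lact (monom u * monom v) t"
    by (rule qlinear_eqI[OF qlinear_compose[OF qlinear_lact(2) qlinear_lact(2)] qlinear_lact(2)])
      (simp add: lact_monom monom_mult lact_words_def)
qed (rule qlinear_lact qlinear_compose[OF qlinear_lact(2) qlinear_lact(1)]
    qlinear_compose[OF qlinear_lact(1) qlinear_mult_left]
    qlinear_compose[OF qlinear_lact(1) qlinear_mult_right])+

lemma ract_ract: "ract (ract t a) b = ract t (a * b)"
proof (rule bilinear_eqI[of "\<lambda>a b. ract (ract t a) b" "\<lambda>a b. ract t (a * b)"])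
  fix u v
  show "ract (ract t (monom u)) (monom v) = ract t (monom u * monom v)"
    by (rule qlinear_eqI[OF qlinear_compose[OF qlinear_ract(1) qlinear_ract(1)] qlinear_ract(1)])
      (simp add: ract_monom monom_mult ract_words_def split: list.splits)
qed (rule qlinear_ract qlinear_compose[OF qlinear_ract(1) qlinear_ract(2)]
    qlinear_compose[OF qlinear_ract(2) qlinear_mult_left]
    qlinear_compose[OF qlinear_ract(2) qlinear_mult_right])+

lemma lact_ract: "lact a (ract t b) = ract (lact a t) b"
proof (rule bilinear_eqI[of "\<lambda>a b. lact a (ract t b)" "\<lambda>a b. ract (lact a t) b"])
  fix u v
  show "lact (monom u) (ract t (monom v)) = ract (lact (monom u) t) (monom v)"
    by (rule qlinear_eqI[OF qlinear_compose[OF qlinear_lact(2) qlinear_ract(1)]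
          qlinear_compose[OF qlinear_ract(1) qlinear_lact(2)]])
      (simp add: ract_monom lact_monom ract_words_def lact_words_def split: list.splits)
qed (rule qlinear_lact qlinear_ract qlinear_compose[OF qlinear_lact(2) qlinear_ract(2)]
    qlinear_compose[OF qlinear_ract(1) qlinear_lact(1)])+

lemma lact_one: "lact 1 t = t"
  by (rule qlinear_eqI[of "lact 1" "\<lambda>t. t"])
    (simp_all add: qlinear_lact qlinear_id one_monom lact_monom lact_words_def)

lemma ract_one: "ract t 1 = t"
  by (rule qlinear_eqI[of "\<lambda>t. ract t 1" "\<lambda>t. t"])
    (auto simp add: qlinear_ract qlinear_id one_monom ract_monom ract_words_def split: list.splits)

lemma qlinear_emb: "qlinear emb"
  by (simp add: emb_def)

lemma ract_pure: "ract (pure_tensor (w # ws)) b = pure_tensor ((w * b) # ws)"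
proof -
  have "ract (emb w * t) b = emb (w * b) * t" for t
  proof (rule bilinear_eqI[of "\<lambda>w b. ract (emb w * t) b" "\<lambda>w b. emb (w * b) * t"])
    fix u v
    show "ract (emb (monom u) * t) (monom v) = emb (monom u * monom v) * t"
      by (rule qlinear_eqI[OF qlinear_compose[OF qlinear_ract(1) qlinear_mult_right]
            qlinear_mult_right])
        (simp add: emb_def monom_mult ract_monom ract_words_def)
  qed (rule qlinear_ract
      qlinear_compose[OF qlinear_ract(1) qlinear_compose[OF qlinear_mult_left qlinear_emb]]
      qlinear_compose[OF qlinear_compose[OF qlinear_mult_left qlinear_emb] qlinear_mult_left]
      qlinear_compose[OF qlinear_compose[OF qlinear_mult_left qlinear_emb] qlinear_mult_right])+
  then show ?thesis by (simp add: pure_tensor_def)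
qed

lemma lact_pure: "lact a (pure_tensor (ws @ [w])) = pure_tensor (ws @ [a * w])"
proof -
  have "lact a (t * emb w) = t * emb (a * w)" for t
  proof (rule bilinear_eqI[of "\<lambda>a w. lact a (t * emb w)" "\<lambda>a w. t * emb (a * w)"])
    fix u v
    show "lact (monom u) (t * emb (monom v)) = t * emb (monom u * monom v)"
      by (rule qlinear_eqI[OF qlinear_compose[OF qlinear_lact(2) qlinear_mult_left]
            qlinear_mult_left])
        (simp add: emb_def monom_mult lact_monom lact_words_def)
  qed (rule qlinear_lact
      qlinear_compose[OF qlinear_lact(2) qlinear_compose[OF qlinear_mult_right qlinear_emb]]
      qlinear_compose[OF qlinear_compose[OF qlinear_mult_right qlinear_emb] qlinear_mult_left]
      qlinear_compose[OF qlinear_compose[OF qlinear_mult_right qlinear_emb] qlinear_mult_right])+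
  then show ?thesis by (simp add: pure_tensor_def)
qed

lemma mult_tensor_pure: "mult_tensor (pure_tensor ws) = prod_list ws"
proof -
  have l: "qlinear mult_tensor" by (simp add: mult_tensor_def)
  have m: "mult_tensor (s * t) = mult_tensor s * mult_tensor t" for s t
  proof (rule bilinear_eqI[of "\<lambda>s t. mult_tensor (s * t)" "\<lambda>s t. mult_tensor s * mult_tensor t"])
    show "mult_tensor (monom us * monom vs) = mult_tensor (monom us) * mult_tensor (monom vs)"
      for us vs by (simp add: monom_mult mult_tensor_def)
  qed (rule qlinear_compose[OF l qlinear_mult_left] qlinear_compose[OF l qlinear_mult_right]
      qlinear_compose[OF qlinear_mult_left l] qlinear_compose[OF qlinear_mult_right l])+
  have e: "mult_tensor (emb w) = w" for w
    by (rule qlinear_eqI[of "\<lambda>w. mult_tensor (emb w)" "\<lambda>w. w"])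
      (simp_all add: qlinear_compose[OF l qlinear_emb] qlinear_id,
        simp add: emb_def mult_tensor_def)
  show ?thesis
    by (induction ws) (simp_all add: pure_tensor_def m e, simp add: one_monom mult_tensor_def)
qed

lemma subspace_tensor_power: "qvs.subspace (tensor_power m)"
  unfolding qvs.subspace_def tensor_power_def
  by (auto simp: in_keys_iff lookup_add)

lemma lin_ext_in_subspace:
  assumes "qvs.subspace V" "\<And>u. u \<in> Poly_Mapping.keys p \<Longrightarrow> f u \<in> V"
  shows "lin_ext f p \<in> V"
  unfolding lin_ext_def using assms by (intro qvs.subspace_sum qvs.subspace_scale)

lemma lact_tensor_power: "t \<in> tensor_power m \<Longrightarrow> lact a t \<in> tensor_power m"
  unfolding lact_def
  by (intro lin_ext_in_subspace subspace_tensor_power)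
    (auto simp: tensor_power_def lact_words_def)

lemma ract_tensor_power: "t \<in> tensor_power m \<Longrightarrow> ract t b \<in> tensor_power m"
  unfolding ract_def
  by (intro lin_ext_in_subspace subspace_tensor_power)
    (auto simp: tensor_power_def ract_words_def split: list.splits)

lemma pure_tensor_in_tensor_power: "pure_tensor ws \<in> tensor_power (length ws)"
proof (induction ws)
  case Nil
  then show ?case by (simp add: pure_tensor_def tensor_power_def zero_list_def)
next
  case (Cons w ws)
  have "u = 1 + length ws" if "us \<in> Poly_Mapping.keys (emb w * pure_tensor ws)" "u = length us"
    for us u
  proof -
    from that keys_mult[of "emb w" "pure_tensor ws"] obtain a b where
      ab: "us = a + b" "a \<in> Poly_Mapping.keys (emb w)" "b \<in> Poly_Mapping.keys (pure_tensor ws)"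
      by blast
    have "emb w \<in> tensor_power 1"
      unfolding emb_def
      by (intro lin_ext_in_subspace subspace_tensor_power) (simp add: tensor_power_def)
    with ab Cons show ?thesis by (auto simp: tensor_power_def plus_list_def that(2))
  qed
  then show ?case by (simp add: tensor_power_def) (simp add: pure_tensor_def)
qed

text \<open>
  \<open>twisted_derivation m g t D\<close>: the map \<open>D\<close> into the \<open>m\<close>-th tensor power is linear, kills
  \<open>1\<close>, sends \<open>x\<close> to \<open>t\<close> and \<open>y\<close> to \<open>- t\<close>, and obeys the Leibniz rule with respect to the
  bimodule structure pulled back along \<open>g\<close>. Such a map exists and is unique, see
  \<open>twisted_derivation_ex1\<close>, \<open>C_spec\<close> and \<open>C_bar_spec\<close>.
\<close>

definition twisted_derivation ::
    "nat \<Rightarrow> (ncpoly \<Rightarrow> ncpoly) \<Rightarrow> tensor \<Rightarrow> (ncpoly \<Rightarrow> tensor) \<Rightarrow> bool"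
  where "twisted_derivation m g t D \<longleftrightarrow>
    (\<forall>w. D w \<in> tensor_power m) \<and> qlinear D \<and> D 1 = 0 \<and> D X = t \<and> D Y = - t \<and>
    (\<forall>w w'. D (w * w') = ract (D w) (g w') + lact (g w) (D w'))"

definition C :: "nat \<Rightarrow> ncpoly \<Rightarrow> tensor"
  where "C n = (THE D. twisted_derivation (n + 2) id
    (pure_tensor ([X] @ replicate n Z @ [Y])) D)"

definition C_bar :: "nat \<Rightarrow> ncpoly \<Rightarrow> tensor"
  where "C_bar n = (THE D. twisted_derivation (n + 2) (inv gamma)
    (pure_tensor ([X] @ replicate (n + 1) Y)) D)"

definition rho :: "nat \<Rightarrow> ncpoly \<Rightarrow> ncpoly"
  where "rho n = mult_tensor \<circ> C n"

definition rho_bar :: "nat \<Rightarrow> ncpoly \<Rightarrow> ncpoly"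
  where "rho_bar n = mult_tensor \<circ> C_bar n"

primrec deriv_words :: "(ncpoly \<Rightarrow> ncpoly) \<Rightarrow> tensor \<Rightarrow> letter list \<Rightarrow> tensor" where
  "deriv_words g t [] = 0"
| "deriv_words g t (l # w) =
    ract (case l of Lx \<Rightarrow> t | Ly \<Rightarrow> - t) (g (monom w)) + lact (g (monom [l])) (deriv_words g t w)"

lemma deriv_words_append:
  assumes g: "alg_hom g"
  shows "deriv_words g t (u @ v) =
    ract (deriv_words g t u) (g (monom v)) + lact (g (monom u)) (deriv_words g t v)"
proof (induction u)
  case Nil
  have "g (monom []) = 1" using g by (simp add: alg_hom_def flip: one_monom)
  moreover have "ract 0 (g (monom v)) = 0"
    using qlinear_scale[OF qlinear_ract(1), of 0 0] by simp
  ultimately show ?case by (simp add: lact_one)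
next
  case (Cons l u)
  have "g (monom (a @ b)) = g (monom a) * g (monom b)" for a b
    using g by (simp add: alg_hom_def flip: monom_mult)
  from this[of "[l]" u] this[of u v] Cons show ?case
    by (simp add: qlinear_add[OF qlinear_lact(2)] qlinear_add[OF qlinear_ract(1)]
        lact_lact ract_ract lact_ract add.assoc)
qed

lemma twisted_derivation_exists:
  assumes g: "alg_hom g" and t: "t \<in> tensor_power m"
  shows "twisted_derivation m g t (lin_ext (deriv_words g t))"
proof -
  let ?D = "lin_ext (deriv_words g t)"
  have g1: "g (monom []) = 1" "g 1 = 1" and gl: "qlinear g"
    using g by (simp_all add: alg_hom_def flip: one_monom)
  have l: "qlinear ?D" by simp
  have l0: "lact a 0 = 0" for a using qlinear_scale[OF qlinear_lact(2), of a 0 0] by simp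
  have mt: "- t \<in> tensor_power m"
    using qvs.subspace_neg[OF subspace_tensor_power t] .
  have dw: "deriv_words g t w \<in> tensor_power m" for w
    by (induction w)
      (auto intro!: qvs.subspace_add[OF subspace_tensor_power] lact_tensor_power
        ract_tensor_power t mt qvs.subspace_0[OF subspace_tensor_power] split: letter.split)
  have "?D w \<in> tensor_power m" for w
    by (intro lin_ext_in_subspace subspace_tensor_power dw)
  moreover have "?D (p * q) = ract (?D p) (g q) + lact (g p) (?D q)" for p q
  proof (rule bilinear_eqI[of "\<lambda>p q. ?D (p * q)" "\<lambda>p q. ract (?D p) (g q) + lact (g p) (?D q)"])
    show "?D (monom u * monom v) =
        ract (?D (monom u)) (g (monom v)) + lact (g (monom u)) (?D (monom v))" for u v
      by (simp add: monom_mult deriv_words_append[OF g])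
  qed (rule qlinear_compose[OF l qlinear_mult_left] qlinear_compose[OF l qlinear_mult_right]
      qlinear_plus[OF qlinear_compose[OF qlinear_ract(1) l] qlinear_compose[OF qlinear_lact(1) gl]]
      qlinear_plus[OF qlinear_compose[OF qlinear_ract(2) gl] qlinear_compose[OF qlinear_lact(2) l]])+
  moreover have "?D 1 = 0" by (simp add: one_monom)
  moreover have "?D X = t" "?D Y = - t"
    by (simp_all add: X_def Y_def g1 ract_one l0)
  ultimately show ?thesis by (simp add: twisted_derivation_def)
qed

lemma twisted_derivation_unique:
  assumes D: "twisted_derivation m g t D" and E: "twisted_derivation m g t E"
  shows "D = E"
proof
  fix p
  show "D p = E p"
  proof (rule qlinear_eqI[of D E])
    show "qlinear D" "qlinear E" using D E by (simp_all add: twisted_derivation_def)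
    show "D (monom w) = E (monom w)" for w
    proof (induction w)
      case Nil
      then show ?case using D E by (simp add: twisted_derivation_def flip: one_monom)
    next
      case (Cons l w)
      then show ?case using D E by (cases l) (simp_all add: monom_Cons twisted_derivation_def)
    qed
  qed
qed

lemma twisted_derivation_ex1:
  "alg_hom g \<Longrightarrow> t \<in> tensor_power m \<Longrightarrow> \<exists>!D. twisted_derivation m g t D"
  using twisted_derivation_exists twisted_derivation_unique by blast

lemma C_spec: "twisted_derivation (n + 2) id (pure_tensor ([X] @ replicate n Z @ [Y])) (C n)"
  unfolding C_def
proof (rule theI'[OF twisted_derivation_ex1])
  show "alg_hom id" using alg_hom_id by (simp add: id_def)
  show "pure_tensor ([X] @ replicate n Z @ [Y]) \<in> tensor_power (n + 2)"
    using pure_tensor_in_tensor_power[of "[X] @ replicate n Z @ [Y]"] by simp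
qed

lemma C_bar_spec:
  "twisted_derivation (n + 2) (inv gamma) (pure_tensor ([X] @ replicate (n + 1) Y)) (C_bar n)"
  unfolding C_bar_def
proof (rule theI'[OF twisted_derivation_ex1])
  show "alg_hom (inv gamma)" by (simp add: inv_gamma alg_hom_subst)
  show "pure_tensor ([X] @ replicate (n + 1) Y) \<in> tensor_power (n + 2)"
    using pure_tensor_in_tensor_power[of "[X] @ replicate (n + 1) Y"] by simp
qed

text \<open>Only arguments \<open>m \<ge> 1\<close> are meaningful.\<close>

function lucas :: "nat \<Rightarrow> nat \<Rightarrow> int" where
  "lucas n m =
    (if n = 0 then 0
     else if m \<le> n then 2 ^ m - 1
     else (\<Sum>i\<in>{1..n}. lucas n (m - i)))"
  by auto
termination by (relation "measure snd") auto

declare lucas.simps [simp del]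

end

theory Submission
  imports Defs
begin

text \<open>
  Pulled back along \<^term>\<open>gamma\<close>, the derivations kill \<open>y\<close>, so up to the injective maps
  \<open>p \<mapsto> p y\<close> and \<open>p \<mapsto> \<gamma>(p) y\<close> both \<open>\<rho>\<close> and \<open>\<rho>\<close>-bar send a word \<open>v\<close> to the sum of those
  cyclic rotations of \<open>v y\<^sup>n\<close> that start with \<open>x\<close>. This vector depends only on the necklace of
  \<open>v y\<^sup>n\<close>, and distinct necklaces give independent vectors, except that \<open>y\<^sup>n\<^sup>+\<^sup>k\<close> gives zero. The
  preimage of the given space under \<^term>\<open>gamma\<close> is spanned by the \<open>w (y - x)\<close> with \<open>w\<close> of length
  \<open>k - 1\<close> containing an \<open>x\<close>, so the image is spanned by the differences along the edges of a graph
  on the necklaces of length \<open>n + k\<close> that have \<open>n\<close> cyclically consecutive \<open>y\<close> and at least one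
  \<open>x\<close>. Every necklace is joined to that of \<open>x y\<^sup>n\<^sup>+\<^sup>k\<^sup>-\<^sup>1\<close> by removing letters \<open>x\<close> one at a time;
  hence the dimension is the number of necklaces with such a run of \<open>y\<close>, minus two. Burnside's
  lemma for rotations counts them, words without such a run being counted by the Lucas numbers.
\<close>

subsection \<open>Words without a cyclic run\<close>

lemma UNIV_letter: "(UNIV :: letter set) = {Lx, Ly}"
  using letter.exhaust by auto

lemma finite_words: "finite {u :: letter list. length u = m \<and> P u}"
proof -
  have "finite {u :: letter list. set u \<subseteq> UNIV \<and> length u = m}"
    by (rule finite_lists_length_eq) (simp add: UNIV_letter)
  then show ?thesis by (rule rev_finite_subset) auto
qed

lemma card_words: "card {u :: letter list. length u = m} = 2 ^ m"
proof -
  have "card {u :: letter list. set u \<subseteq> UNIV \<and> length u = m} = card (UNIV :: letter set) ^ m"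
    by (rule card_lists_length_eq) (simp add: UNIV_letter)
  also have "card (UNIV :: letter set) = 2" by (simp add: UNIV_letter)
  finally show ?thesis by simp
qed

lemma card_words_Suc:
  "card {v. length v = Suc j \<and> P v} =
    card {v. length v = j \<and> P (Lx # v)} + card {v. length v = j \<and> P (Ly # v)}"
proof -
  let ?A = "\<lambda>l. (#) l ` {v. length v = j \<and> P (l # v)}"
  have eq: "{v. length v = Suc j \<and> P v} = ?A Lx \<union> ?A Ly"
  proof (intro equalityI subsetI)
    fix v assume v: "v \<in> {v. length v = Suc j \<and> P v}"
    then obtain l v' where "v = l # v'" by (cases v) auto
    with v show "v \<in> ?A Lx \<union> ?A Ly" by (cases l) auto
  qed auto
  have "card {v. length v = Suc j \<and> P v} = card (?A Lx) + card (?A Ly)"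
    unfolding eq by (rule card_Un_disjoint) (auto intro!: finite_imageI finite_words)
  moreover have "card (?A l) = card {v. length v = j \<and> P (l # v)}" for l
    by (rule card_image) simp
  ultimately show ?thesis by simp
qed

text \<open>Words are split by the length \<open>b\<close> of the y-block before their first x; the
  word without an x is the last summand.\<close>

lemma card_words_first_x:
  "card {v. length v = j \<and> P v} =
    (\<Sum>b<j. card {v. length v = j - 1 - b \<and> P (replicate b Ly @ Lx # v)})
      + (if P (replicate j Ly) then 1 else 0)"
proof (induction j arbitrary: P)
  case 0
  have "{v. v = [] \<and> P v} = (if P [] then {[]} else {})" by auto
  then show ?case by simp
next
  case (Suc j)
  have "card {v. length v = Suc j \<and> P v} = card {v. length v = j \<and> P (Lx # v)} +
     ((\<Sum>b<j. card {v. length v = j - 1 - b \<and> P (Ly # replicate b Ly @ Lx # v)})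
      + (if P (Ly # replicate j Ly) then 1 else 0))"
    unfolding card_words_Suc using Suc.IH[of "\<lambda>v. P (Ly # v)"] by simp
  then show ?case by (simp add: sum.lessThan_Suc_shift del: sum.lessThan_Suc)
qed

text \<open>Positions wrap around, so a window at least as long as a nonempty word demands y
  everywhere; this matches the initial values of \<open>lucas\<close>.\<close>

definition cyclic_run :: "nat \<Rightarrow> letter list \<Rightarrow> bool"
  where "cyclic_run n u \<longleftrightarrow> (\<exists>s. \<forall>i<n. u ! ((s + i) mod length u) = Ly)"

definition linear_run :: "nat \<Rightarrow> letter list \<Rightarrow> bool"
  where "linear_run n u \<longleftrightarrow> (\<exists>s. s + n \<le> length u \<and> (\<forall>i<n. u ! (s + i) = Ly))"

lemma rotate_inverse: "rotate (length w - j mod length w) (rotate j w) = w"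
proof -
  have "rotate (length w - j mod length w) (rotate (j mod length w) w) = w"
    by (cases "w = []") (simp_all add: rotate_rotate)
  then show ?thesis by (metis rotate_conv_mod)
qed

text \<open>Rotation by \<open>j\<close> moves the start of a window from \<open>s\<close> to
  \<open>s - j\<close>, written without subtraction below zero. The converse is the same implication
  applied to the rotation back.\<close>

lemma cyclic_run_rotate: "cyclic_run n (rotate j u) = cyclic_run n u"
proof (cases "u = []")
  case False
  have *: "cyclic_run n (rotate j u)" if run: "cyclic_run n u" for j and u :: "letter list"
  proof (cases "u = []")
    case False
    let ?m = "length u"
    from run obtain s where s: "\<And>i. i < n \<Longrightarrow> u ! ((s + i) mod ?m) = Ly"
      by (auto simp: cyclic_run_def)
    have "rotate j u ! ((s + (?m - j mod ?m) + i) mod ?m) = Ly" if "i < n" for i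
    proof -
      have "(j + (s + (?m - j mod ?m) + i) mod ?m) mod ?m =
          (j mod ?m + (s + (?m - j mod ?m) + i)) mod ?m"
        by (simp add: mod_simps)
      also have "j mod ?m + (s + (?m - j mod ?m) + i) = s + i + ?m"
        using mod_le_divisor[of ?m j] False by (simp del: mod_le_divisor)
      finally show ?thesis using False s[OF that] by (simp add: nth_rotate)
    qed
    then show ?thesis unfolding cyclic_run_def by (intro exI[of _ "s + (?m - j mod ?m)"]) simp
  qed (use run in simp)
  from *[of u j] *[of "rotate j u" "length u - j mod length u"] show ?thesis
    unfolding rotate_inverse by auto
qed simp

text \<open>A window of letters y cannot cover the leading x, so it does not wrap around.\<close>

lemma cyclic_run_Lx_Cons:
  assumes "n > 0" shows "cyclic_run n (Lx # v) = linear_run n v"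
proof
  let ?m = "Suc (length v)"
  assume "cyclic_run n (Lx # v)"
  then obtain s0 where s0: "\<And>i. i < n \<Longrightarrow> (Lx # v) ! ((s0 + i) mod ?m) = Ly"
    by (auto simp: cyclic_run_def)
  define s where "s = s0 mod ?m"
  have s: "(Lx # v) ! ((s + i) mod ?m) = Ly" if "i < n" for i
    using s0[OF that] by (simp only: s_def mod_add_left_eq)
  have "s < ?m" by (simp add: s_def)
  have "s > 0" using s[of 0] assms \<open>s < ?m\<close> by (cases s) auto
  \<comment> \<open>At offset \<open>?m - s\<close> the window would return to position 0, which
    holds x.\<close>
  have "\<not> ?m - s < n"
    using s[of "?m - s"] \<open>s < ?m\<close> by auto
  then have le: "s + n \<le> ?m" using \<open>s < ?m\<close> by linarith
  have "v ! (s - 1 + i) = Ly" if "i < n" for i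
    using s[OF that] that le \<open>s > 0\<close> by (cases s) auto
  with le \<open>s > 0\<close> show "linear_run n v"
    unfolding linear_run_def by (intro exI[of _ "s - 1"]) auto
next
  assume "linear_run n v"
  then obtain s where "s + n \<le> length v" "\<And>i. i < n \<Longrightarrow> v ! (s + i) = Ly"
    by (auto simp: linear_run_def)
  then show "cyclic_run n (Lx # v)"
    unfolding cyclic_run_def by (intro exI[of _ "Suc s"]) auto
qed

text \<open>Rotating by \<open>a\<close> moves the leading block to the end and leaves x in
  front.\<close>

lemma cyclic_run_split:
  assumes "n > 0"
  shows "cyclic_run n (replicate a Ly @ Lx # v) = linear_run n (v @ replicate a Ly)"
  using cyclic_run_rotate[of n a "replicate a Ly @ Lx # v"] cyclic_run_Lx_Cons[OF assms]
  by (metis append_Cons length_replicate rotate_append)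

lemma linear_run_replicate: "linear_run n (replicate b Ly) \<longleftrightarrow> n \<le> b"
  unfolding linear_run_def by (auto intro: exI[of _ 0])

text \<open>A window of letters y cannot cross the x at position \<open>b\<close>: it lies in the
  first block or inside \<open>v\<close>.\<close>

lemma linear_run_split:
  assumes "n > 0"
  shows "linear_run n (replicate b Ly @ Lx # v) \<longleftrightarrow> n \<le> b \<or> linear_run n v"
proof (intro iffI disjCI)
  assume "linear_run n (replicate b Ly @ Lx # v)" and b: "\<not> linear_run n v"
  then obtain s where le: "s + n \<le> b + Suc (length v)"
    and s: "\<And>i. i < n \<Longrightarrow> (replicate b Ly @ Lx # v) ! (s + i) = Ly"
    by (auto simp: linear_run_def)
  show "n \<le> b"
  proof (rule ccontr)
    assume "\<not> n \<le> b"
    \<comment> \<open>A window longer than \<open>b\<close> that starts at or before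
      \<open>b\<close> contains position \<open>b\<close>.\<close>
    have "s > b"
    proof (rule ccontr)
      assume "\<not> b < s"
      then have "b - s < n" "s + (b - s) = b" using \<open>\<not> n \<le> b\<close> by auto
      with s[of "b - s"] show False by (simp add: nth_append)
    qed
    have "v ! (s - Suc b + i) = Ly" if "i < n" for i
      using s[OF that] \<open>s > b\<close> by (simp add: nth_append nth_Cons' split: if_splits)
    with le \<open>s > b\<close> b show False
      unfolding linear_run_def by (auto dest!: spec[of _ "s - Suc b"])
  qed
next
  assume *: "n \<le> b \<or> linear_run n v"
  show "linear_run n (replicate b Ly @ Lx # v)"
  proof (cases "n \<le> b")
    case True
    then show ?thesis
      unfolding linear_run_def by (intro exI[of _ 0]) (simp add: nth_append)
  next
    case False
    with * obtain s where "s + n \<le> length v" "\<And>i. i < n \<Longrightarrow> v ! (s + i) = Ly"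
      by (auto simp: linear_run_def)
    then show ?thesis
      unfolding linear_run_def by (intro exI[of _ "Suc (b + s)"]) (auto simp: nth_append)
  qed
qed

lemma cyclic_run_replicate: "m > 0 \<Longrightarrow> cyclic_run n (replicate m Ly)"
  by (simp add: cyclic_run_def)

text \<open>At least \<open>m\<close> consecutive positions exhaust all residues modulo
  \<open>m\<close>.\<close>

lemma cyclic_run_short:
  assumes "0 < m" "m \<le> n" "length u = m"
  shows "cyclic_run n u \<longleftrightarrow> u = replicate m Ly"
proof
  assume "cyclic_run n u"
  then obtain s where s: "\<And>i. i < n \<Longrightarrow> u ! ((s + i) mod m) = Ly"
    using assms by (auto simp: cyclic_run_def)
  have "u ! j = Ly" if "j < m" for j
  proof -
    \<comment> \<open>This is \<open>j - s\<close> modulo \<open>m\<close>, the offset at which the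
      window meets position \<open>j\<close>.\<close>
    let ?i = "(j + (m - s mod m)) mod m"
    have "(s + ?i) mod m = (s mod m + (j + (m - s mod m))) mod m"
      by (simp add: mod_simps)
    also have "s mod m + (j + (m - s mod m)) = j + m"
      using mod_le_divisor[of m s] assms by (simp del: mod_le_divisor)
    finally have "(s + ?i) mod m = j" using that by simp
    moreover have "?i < n" using assms mod_less_divisor[of m "j + (m - s mod m)"] by linarith
    ultimately show ?thesis using s[of ?i] by simp
  qed
  with assms show "u = replicate m Ly" by (intro nth_equalityI) auto
qed (use assms cyclic_run_replicate in auto)

text \<open>
  A word \<open>y\<^sup>a x v\<close> has a cyclic run iff \<open>v y\<^sup>a\<close> has a linear one. For fixed \<open>a\<close>, removing the block
  \<open>y\<^sup>b x\<close> that starts \<open>v\<close> gives the recurrence, which survives summation over \<open>a\<close>.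
\<close>

definition run_free :: "nat \<Rightarrow> nat \<Rightarrow> nat \<Rightarrow> nat"
  where "run_free n a j = card {v. length v = j \<and> \<not> linear_run n (v @ replicate a Ly)}"

lemma run_free_rec:
  assumes "n > 0"
  shows "run_free n a j =
    (\<Sum>b<n. if b < j then run_free n a (j - 1 - b) else 0) + (if j + a < n then 1 else 0)"
proof -
  \<comment> \<open>Here \<open>b\<close> is the length of the y-block before the first x of
    \<open>v\<close>; from \<open>b = n\<close> on, the block is itself a run. The last summand is
    the case of \<open>v\<close> consisting of letters y only.\<close>
  have "run_free n a j = (\<Sum>b<j. if b < n then run_free n a (j - 1 - b) else 0)
      + (if j + a < n then 1 else 0)"
    unfolding run_free_def card_words_first_x[of j "\<lambda>v. \<not> linear_run n (v @ replicate a Ly)"]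
    by (intro arg_cong2[of _ _ _ _ "(+)"] sum.cong)
      (auto simp: linear_run_split[OF assms] linear_run_replicate not_le simp flip: replicate_add)
  also have "(\<Sum>b<j. if b < n then run_free n a (j - 1 - b) else 0) =
      (\<Sum>b<n. if b < j then run_free n a (j - 1 - b) else 0)"
    by (rule sum.mono_neutral_cong) auto
  finally show ?thesis .
qed

text \<open>The summation index is the length of the leading y-block; the word without an x has a
  run and drops out.\<close>

lemma card_not_cyclic_run:
  assumes "n > 0" "m > 0"
  shows "card {u. length u = m \<and> \<not> cyclic_run n u} = (\<Sum>a<m. run_free n a (m - 1 - a))"
  unfolding card_words_first_x[of m "\<lambda>u. \<not> cyclic_run n u"] run_free_def
  using assms by (simp add: cyclic_run_split cyclic_run_replicate)

lemma card_not_cyclic_run_rec: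
  assumes n: "n > 0" and m: "n < m"
  shows "card {u. length u = m \<and> \<not> cyclic_run n u} =
    (\<Sum>i\<in>{1..n}. card {u. length u = m - i \<and> \<not> cyclic_run n u})"
proof -
  have "card {u. length u = m \<and> \<not> cyclic_run n u} =
      (\<Sum>a<m. \<Sum>b<n. if b < m - 1 - a then run_free n a (m - 1 - a - 1 - b) else 0)"
    unfolding card_not_cyclic_run[OF n less_trans[OF n m]]
  proof (intro sum.cong refl)
    fix a assume "a \<in> {..<m}"
    \<comment> \<open>The two lengths add up to \<open>m - 1\<close>, which is at least
      \<open>n\<close>, so the constant term of the recurrence vanishes.\<close>
    then have "\<not> m - 1 - a + a < n" using m by auto
    then show "run_free n a (m - 1 - a) =
        (\<Sum>b<n. if b < m - 1 - a then run_free n a (m - 1 - a - 1 - b) else 0)"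
      using run_free_rec[OF n, of a "m - 1 - a"] by simp
  qed
  also have "\<dots> = (\<Sum>b<n. \<Sum>a<m. if b < m - 1 - a then run_free n a (m - 1 - a - 1 - b) else 0)"
    by (rule sum.swap)
  \<comment> \<open>For fixed \<open>b\<close>, the inner sum counts the run-free words of length
    \<open>m - Suc b\<close> by their leading block.\<close>
  also have "\<dots> = (\<Sum>b<n. \<Sum>a<m - Suc b. run_free n a (m - Suc b - 1 - a))"
    by (intro sum.cong refl sum.mono_neutral_cong_right)
      (auto simp: algebra_simps intro!: arg_cong[of _ _ "run_free n _"])
  also have "\<dots> = (\<Sum>b<n. card {u. length u = m - Suc b \<and> \<not> cyclic_run n u})"
    using m by (intro sum.cong refl card_not_cyclic_run[symmetric] n) auto
  also have "\<dots> = (\<Sum>i\<in>{1..n}. card {u. length u = m - i \<and> \<not> cyclic_run n u})"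
    by (rule sum.reindex_bij_witness[of _ "\<lambda>i. i - 1" Suc]) auto
  finally show ?thesis .
qed

text \<open>The initial values agree: for \<open>n = 0\<close> the empty window is always a run, and
  for \<open>m\<close> up to \<open>n\<close> only the word of letters y has one. Beyond that both
  sides obey the same recurrence.\<close>

lemma card_not_cyclic_run_eq_lucas:
  "m > 0 \<Longrightarrow> int (card {u. length u = m \<and> \<not> cyclic_run n u}) = lucas n m"
proof (induction m rule: less_induct)
  case (less m)
  consider "n = 0" | "n > 0" "m \<le> n" | "n > 0" "n < m" by linarith
  then show ?case
  proof cases
    case 1
    then show ?thesis by (simp add: cyclic_run_def lucas.simps)
  next
    case 2
    have "{u. length u = m \<and> \<not> cyclic_run n u} = {u. length u = m} - {replicate m Ly}"
      using cyclic_run_short[OF less.prems 2(2)] by auto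
    then show ?thesis
      using 2 finite_words[of m "\<lambda>_. True"]
      by (simp add: card_Diff_subset card_words lucas.simps of_nat_diff)
  next
    case 3
    then show ?thesis
      using less by (simp add: card_not_cyclic_run_rec lucas.simps[of n m])
  qed
qed

lemma card_cyclic_run:
  assumes "m > 0"
  shows "(of_nat (card {u. length u = m \<and> cyclic_run n u}) :: rat) = 2 ^ m - of_int (lucas n m)"
proof -
  have "2 ^ m = card ({u. length u = m \<and> cyclic_run n u} \<union> {u. length u = m \<and> \<not> cyclic_run n u})"
    unfolding card_words[symmetric] by (rule arg_cong[of _ _ card]) auto
  also have "\<dots> = card {u. length u = m \<and> cyclic_run n u}
      + card {u. length u = m \<and> \<not> cyclic_run n u}"
    by (rule card_Un_disjoint) (auto intro: finite_words)
  finally have "(2 ^ m :: int) = int (card {u. length u = m \<and> cyclic_run n u}) + lucas n m"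
    unfolding card_not_cyclic_run_eq_lucas[OF assms, symmetric]
    by (metis of_nat_add of_nat_numeral of_nat_power)
  then have "(of_int (2 ^ m) :: rat) = of_int (int (card {u. length u = m \<and> cyclic_run n u}) + lucas n m)"
    by simp
  then show ?thesis by simp
qed

subsection \<open>Counting necklaces\<close>

definition orbit :: "'a list \<Rightarrow> 'a list set"
  where "orbit w = range (\<lambda>i. rotate i w)"

lemma orbit_refl: "w \<in> orbit w"
  unfolding orbit_def by (rule range_eqI[of _ _ 0]) simp

lemma rotate_in_orbit: "rotate i w \<in> orbit w"
  by (simp add: orbit_def)

lemma orbit_rotate: "orbit (rotate j w) = orbit w"
proof -
  have *: "orbit (rotate j w) \<subseteq> orbit w" for j and w :: "'a list"
    by (auto simp: orbit_def rotate_rotate)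
  from *[of j w] *[of "length w - j mod length w" "rotate j w"] show ?thesis
    unfolding rotate_inverse by auto
qed

lemma orbit_eq_iff: "orbit u = orbit w \<longleftrightarrow> u \<in> orbit w"
proof
  assume "u \<in> orbit w"
  then obtain i where "u = rotate i w" by (auto simp: orbit_def)
  then show "orbit u = orbit w" by (simp add: orbit_rotate)
qed (use orbit_refl in blast)

text \<open>The range starts at 1, as in the count of integers with given gcd by the totient; the
  full rotation replaces the trivial one.\<close>

lemma orbit_upto: "w \<noteq> [] \<Longrightarrow> orbit w = (\<lambda>i. rotate i w) ` {0<..length w}"
proof (intro equalityI subsetI)
  fix u assume w: "w \<noteq> []" and "u \<in> orbit w"
  then obtain i where u: "u = rotate i w" by (auto simp: orbit_def)
  show "u \<in> (\<lambda>i. rotate i w) ` {0<..length w}"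
  proof (cases "i mod length w = 0")
    case True
    with u w show ?thesis by (auto intro!: image_eqI[of _ _ "length w"])
  next
    case False
    with u w show ?thesis
      by (intro image_eqI[of _ _ "i mod length w"]) (auto simp: rotate_conv_mod[of i] less_imp_le)
  qed
qed (auto simp: orbit_def)

lemma inj_rotate: "inj (rotate j)"
proof (rule injI)
  fix u v :: "'a list" assume eq: "rotate j u = rotate j v"
  then have "length u = length v" by (metis length_rotate)
  then show "u = v" using eq by (metis rotate_inverse)
qed

text \<open>Orbit-stabilizer in summed form: the fibres of \<open>i \<mapsto> rotate i w\<close>
  over the orbit partition the \<open>length w\<close> indices, and the fibre over \<open>u\<close>
  is as large as the stabilizer of \<open>u\<close>.\<close>

lemma sum_stabilizer_orbit:
  fixes w :: "'a list"
  assumes "w \<noteq> []"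
  shows "(\<Sum>u\<in>orbit w. card {i\<in>{0<..length w}. rotate i u = u}) = length w"
proof -
  let ?N = "length w" and ?I = "{0<..length w}"
  define f where "f u v = card {i\<in>?I. rotate i u = v}" for u v :: "'a list"
  have step: "f u (rotate1 v) = f u v" if "length u = ?N" for u v
  proof -
    \<comment> \<open>The cyclic shift of \<open>?I\<close>, which carries the indices leading to
      \<open>v\<close> onto those leading to \<open>rotate1 v\<close>.\<close>
    let ?s = "\<lambda>i. Suc (i mod ?N)"
    have rot: "rotate (?s i) u = rotate1 (rotate i u)" for i
      using that rotate_conv_mod[of i u] by simp
    have inj: "inj_on ?s ?I"
    proof (rule inj_onI)
      fix i j assume "i \<in> ?I" "j \<in> ?I" "?s i = ?s j"
      then show "i = j"
        by (cases "i = ?N"; cases "j = ?N") auto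
    qed
    have surj: "?s ` ?I = ?I"
      by (rule endo_inj_surj[OF _ _ inj]) (use assms in \<open>auto simp: Suc_le_eq\<close>)
    have "{i\<in>?I. rotate i u = rotate1 v} = ?s ` {i\<in>?I. rotate i u = v}"
    proof (intro equalityI subsetI)
      fix i assume i: "i \<in> {i\<in>?I. rotate i u = rotate1 v}"
      then obtain j where j: "j \<in> ?I" "i = ?s j" using surj by blast
      with i have "rotate1 (rotate j u) = rotate1 v" using rot by simp
      then have "rotate j u = v" using injD[OF inj_rotate[of 1]] by fastforce
      with j show "i \<in> ?s ` {i\<in>?I. rotate i u = v}" by blast
    next
      fix i assume "i \<in> ?s ` {i\<in>?I. rotate i u = v}"
      then obtain j where "j \<in> ?I" "rotate j u = v" "i = ?s j" by blast
      then show "i \<in> {i\<in>?I. rotate i u = rotate1 v}" using rot[of j] surj by blast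
    qed
    moreover have "card (?s ` {i\<in>?I. rotate i u = v}) = card {i\<in>?I. rotate i u = v}"
      by (rule card_image, rule inj_on_subset[OF inj]) auto
    ultimately show ?thesis unfolding f_def by (simp only:)
  qed
  have f_rot: "f u (rotate j v) = f u v" if "length u = ?N" for j u v
    by (induction j) (simp_all add: step[OF that])
  have f_eq: "f w u = f u u" if u: "u \<in> orbit w" for u
  proof -
    obtain j where j: "u = rotate j w" using u by (auto simp: orbit_def)
    \<comment> \<open>Rotations commute and are injective, so all words of an orbit have the same
      stabilizer.\<close>
    have "f u u = f w w"
      unfolding f_def j rotate_rotate add.commute[of _ j]
      unfolding rotate_rotate[symmetric, of j] inj_eq[OF inj_rotate] ..
    with f_rot[of w j w] j show ?thesis by simp
  qed
  have "?N = card ?I" by simp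
  also have "\<dots> = (\<Sum>i\<in>?I. 1)" by simp
  also have "\<dots> = (\<Sum>u\<in>(\<lambda>i. rotate i w) ` ?I. \<Sum>i\<in>{i\<in>?I. rotate i w = u}. 1)"
    by (rule sum.image_gen) simp
  also have "\<dots> = (\<Sum>u\<in>orbit w. f u u)"
    unfolding orbit_upto[OF assms] using f_eq by (simp add: f_def orbit_upto[OF assms])
  finally show ?thesis by (simp add: f_def)
qed

text \<open>Pairs of a word and a rotation fixing it are counted twice: by orbits, each contributing
  \<open>N\<close>, and by rotations.\<close>

lemma burnside_rotation:
  assumes "finite S" "N > 0" "\<And>w. w \<in> S \<Longrightarrow> length w = N" "\<And>w i. w \<in> S \<Longrightarrow> rotate i w \<in> S"
  shows "N * card (orbit ` S) = (\<Sum>i\<in>{0<..N}. card {w\<in>S. rotate i w = w})"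
proof -
  let ?f = "\<lambda>w. card {i\<in>{0<..N}. rotate i w = w}"
  have "(\<Sum>w\<in>S. ?f w) = (\<Sum>c\<in>orbit ` S. \<Sum>w\<in>{w\<in>S. orbit w = c}. ?f w)"
    by (rule sum.image_gen) fact
  also have "\<dots> = (\<Sum>c\<in>orbit ` S. N)"
  proof (intro sum.cong refl)
    fix c assume "c \<in> orbit ` S"
    then obtain v where v: "v \<in> S" "c = orbit v" by blast
    have "{w\<in>S. orbit w = c} = orbit v"
      using v assms(4) by (auto simp: orbit_eq_iff) (auto simp: orbit_def)
    then show "(\<Sum>w\<in>{w\<in>S. orbit w = c}. ?f w) = N"
      using sum_stabilizer_orbit[of v] assms(2,3) v by auto
  qed
  also have "\<dots> = N * card (orbit ` S)" by simp
  finally have "N * card (orbit ` S) = (\<Sum>w\<in>S. ?f w)" ..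
  also have "\<dots> = (\<Sum>w\<in>S. \<Sum>i\<in>{0<..N}. if rotate i w = w then 1 else 0)"
    by (simp add: sum.If_cases Int_def)
  also have "\<dots> = (\<Sum>i\<in>{0<..N}. \<Sum>w\<in>S. if rotate i w = w then 1 else 0)"
    by (rule sum.swap)
  also have "\<dots> = (\<Sum>i\<in>{0<..N}. card {w\<in>S. rotate i w = w})"
    using assms(1) by (simp add: sum.If_cases Int_def)
  finally show ?thesis .
qed

text \<open>Multiples of a period are periods, and by Bezout the gcd is a multiple of
  \<open>i\<close> up to full rotations.\<close>

lemma rotate_gcd_iff:
  assumes "i > 0"
  shows "rotate i w = w \<longleftrightarrow> rotate (gcd i (length w)) w = w"
proof
  have mult: "rotate (d * j) w = w" if "rotate d w = w" for d j
    by (induction j) (simp_all add: that flip: rotate_rotate)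
  show "rotate i w = w" if "rotate (gcd i (length w)) w = w"
    using mult[OF that, of "i div gcd i (length w)"] by simp
  assume i: "rotate i w = w"
  obtain a b where "i * a = length w * b + gcd i (length w)"
    using bezout_nat[of i "length w"] assms by auto
  then have "rotate (gcd i (length w) + length w * b) w = w"
    using mult[OF i, of a] by (metis add.commute)
  then show "rotate (gcd i (length w)) w = w"
    by (simp flip: rotate_rotate)
qed

text \<open>A fixed word repeats its first \<open>d\<close> letters. Since \<open>d\<close> divides
  \<open>N\<close>, reading it cyclically is the same as reading those \<open>d\<close> letters
  cyclically, so runs correspond.\<close>

lemma card_rotation_fixed:
  assumes "N > 0" "d dvd N"
  shows "card {w. length w = N \<and> cyclic_run n w \<and> rotate d w = w} =
    card {u. length u = d \<and> cyclic_run n u}"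
proof -
  have d: "d > 0" "d \<le> N" using assms by (auto intro: Nat.gr0I dvd_imp_le)
  \<comment> \<open>The periodic extension to length \<open>N\<close>, inverse to
    \<open>take d\<close> on the fixed words.\<close>
  define ext where "ext u = map (\<lambda>j. u ! (j mod d)) [0..<N]" for u :: "letter list"
  have run: "cyclic_run n (ext u) = cyclic_run n u" if "length u = d" for u
    using that assms by (simp add: cyclic_run_def ext_def mod_mod_cancel)
  have ext_take: "ext (take d w) = w" if "length w = N" "rotate d w = w" for w
  proof (rule nth_equalityI)
    have per: "w ! ((d * q + r) mod N) = w ! r" if "r < N" for q r
    proof (induction q)
      case (Suc q)
      have "w ! ((d * Suc q + r) mod N) = w ! ((d + (d * q + r) mod N) mod N)"
        by (simp add: mod_simps add.assoc)
      also have "\<dots> = rotate d w ! ((d * q + r) mod N)"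
        using \<open>length w = N\<close> assms(1) by (simp add: nth_rotate)
      finally show ?case using Suc \<open>rotate d w = w\<close> by simp
    qed (use that in simp)
    show "ext (take d w) ! j = w ! j" if "j < length (ext (take d w))" for j
    proof -
      have "j < N" using that by (simp add: ext_def)
      have "j mod d < N" using d mod_less_divisor[of d j] by linarith
      with per[of "j mod d" "j div d"] \<open>j < N\<close> d show ?thesis
        by (simp add: ext_def)
    qed
  qed (use that in \<open>simp add: ext_def\<close>)
  have take_ext: "take d (ext u) = u" if "length u = d" for u
    using that d by (intro nth_equalityI) (auto simp: ext_def)
  have rot_ext: "rotate d (ext u) = ext u" if "length u = d" for u
    using assms d
    by (intro nth_equalityI) (auto simp: ext_def nth_rotate mod_mod_cancel)
  have "bij_betw (take d) {w. length w = N \<and> cyclic_run n w \<and> rotate d w = w}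
      {u. length u = d \<and> cyclic_run n u}"
  proof (rule bij_betw_byWitness[where f' = ext])
    show "take d ` {w. length w = N \<and> cyclic_run n w \<and> rotate d w = w}
        \<subseteq> {u. length u = d \<and> cyclic_run n u}"
      using d run ext_take by (force simp: min_def)
    show "ext ` {u. length u = d \<and> cyclic_run n u}
        \<subseteq> {w. length w = N \<and> cyclic_run n w \<and> rotate d w = w}"
      using run rot_ext by (auto simp: ext_def)
  qed (use ext_take take_ext in auto)
  then show ?thesis by (rule bij_betw_same_card)
qed

text \<open>In Burnside's sum the rotations are grouped by their gcd with \<open>N\<close>; the
  value \<open>d\<close> occurs \<open>totient (N div d)\<close> times.\<close>

lemma card_necklaces:
  assumes "N > 0"
  shows "N * card (orbit ` {w. length w = N \<and> cyclic_run n w}) =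
    (\<Sum>d | d dvd N. totient (N div d) * card {u. length u = d \<and> cyclic_run n u})"
proof -
  let ?S = "{w. length w = N \<and> cyclic_run n w}"
  let ?fix = "\<lambda>d. card {w\<in>?S. rotate d w = w}"
  have "N * card (orbit ` ?S) = (\<Sum>i\<in>{0<..N}. ?fix i)"
    by (rule burnside_rotation) (use assms finite_words in \<open>auto simp: cyclic_run_rotate\<close>)
  also have "\<dots> = (\<Sum>i\<in>{0<..N}. ?fix (gcd i N))"
  proof (intro sum.cong refl)
    fix i assume "i \<in> {0<..N}"
    then have "{w\<in>?S. rotate i w = w} = {w\<in>?S. rotate (gcd i N) w = w}"
      using rotate_gcd_iff[of i] by auto
    then show "?fix i = ?fix (gcd i N)" by simp
  qed
  also have "\<dots> = (\<Sum>d | d dvd N. \<Sum>i\<in>{i\<in>{0<..N}. gcd i N = d}. ?fix (gcd i N))"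
    by (rule sum.group[symmetric]) (use assms in auto)
  also have "\<dots> = (\<Sum>d | d dvd N. totient (N div d) * card {u. length u = d \<and> cyclic_run n u})"
  proof (intro sum.cong refl)
    fix d assume "d \<in> {d. d dvd N}"
    then have d: "d dvd N" by simp
    have "(\<Sum>i\<in>{i\<in>{0<..N}. gcd i N = d}. ?fix (gcd i N)) =
        card {i\<in>{0<..N}. gcd i N = d} * ?fix d" by simp
    also have "card {i\<in>{0<..N}. gcd i N = d} = totient (N div d)"
      by (rule card_gcd_eq_totient) (use assms d in auto)
    also have "?fix d = card {u. length u = d \<and> cyclic_run n u}"
      using card_rotation_fixed[OF assms d, of n] by (simp add: conj_assoc)
    finally show "(\<Sum>i\<in>{i\<in>{0<..N}. gcd i N = d}. ?fix (gcd i N)) =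
        totient (N div d) * card {u. length u = d \<and> cyclic_run n u}" .
  qed
  finally show ?thesis .
qed

subsection \<open>The derivations as cyclic sums\<close>

lemma dim_image_independent:
  assumes f: "qlinear f" "inj f" and B: "qvs.independent B"
  shows "qvs.dim (f ` qvs.span B) = card B"
proof -
  interpret f: Vector_Spaces.linear scale scale f by fact
  have "qvs.independent (f ` B)"
    using f.dependent_inj_imageD[of B] B inj_on_subset[OF f(2)] by blast
  then have "qvs.dim (qvs.span (f ` B)) = card (f ` B)"
    by (simp add: qvs.dim_eq_card_independent)
  then show ?thesis
    using card_image[OF inj_on_subset[OF f(2)], of B] by (simp add: f.span_image)
qed

text \<open>Subtracting a vector that vanishes at all \<open>t j\<close> from the \<open>f i\<close> preserves the hypothesis.\<close>

lemma independent_of_tests: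
  fixes f :: "'i \<Rightarrow> ('a \<Rightarrow>\<^sub>0 rat)"
  assumes I: "finite I"
    and test: "\<And>i j. i \<in> I \<Longrightarrow> j \<in> I \<Longrightarrow> Poly_Mapping.lookup (f i) (t j) \<noteq> 0 \<longleftrightarrow> i = j"
  shows "inj_on f I" "qvs.independent (f ` I)"
proof -
  show inj: "inj_on f I"
    using test by (metis inj_onI)
  show "qvs.independent (f ` I)"
  proof (rule qvs.independent_if_scalars_zero)
    fix c x assume sum: "(\<Sum>x\<in>f ` I. scale (c x) x) = 0" and "x \<in> f ` I"
    then obtain j where j: "j \<in> I" "x = f j" by blast
    have "0 = Poly_Mapping.lookup (\<Sum>i\<in>I. scale (c (f i)) (f i)) (t j)"
      using sum by (simp add: sum.reindex[OF inj])
    also have "\<dots> = (\<Sum>i\<in>I. c (f i) * Poly_Mapping.lookup (f i) (t j))"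
      by (simp add: lookup_sum)
    also have "\<dots> = (\<Sum>i\<in>I. if i = j then c (f i) * Poly_Mapping.lookup (f i) (t j) else 0)"
      using test j(1) by (intro sum.cong) auto
    also have "\<dots> = c x * Poly_Mapping.lookup (f j) (t j)"
      using I j by simp
    finally show "c x = 0" using test[of j j] j by simp
  qed (use I in simp)
qed

lemma Y_power: "Y ^ n = monom (replicate n Ly)"
  by (induction n) (simp_all add: one_monom Y_def monom_mult)

lemma X_power: "X ^ n = monom (replicate n Lx)"
  by (induction n) (simp_all add: one_monom X_def monom_mult)

lemma alg_hom_simps:
  assumes "alg_hom g"
  shows "qlinear g" "g 0 = 0" "g 1 = 1" "g (monom []) = 1" "g (p * q) = g p * g q" "g (p ^ n) = g p ^ n"
    "g (sum f A) = (\<Sum>a\<in>A. g (f a))"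
proof -
  show l: "qlinear g" and 1: "g 1 = 1" and m: "g (p * q) = g p * g q" for p q
    using assms by (auto simp: alg_hom_def)
  show "g 0 = 0" "g (sum f A) = (\<Sum>a\<in>A. g (f a))"
    using l by (rule qlinear_zero qlinear_sum)+
  show "g (monom []) = 1" using 1 by (simp flip: one_monom)
  show "g (p ^ n) = g p ^ n" by (induction n) (simp_all add: 1 m)
qed

text \<open>\<open>D\<close> stands for either derivation composed with \<open>gamma\<close>. By the
  Leibniz rule each x of the word contributes one term, with what follows it multiplied into the
  first tensor factor and what precedes it into the last. The factors \<open>a\<close> and
  \<open>b\<close> make the induction go through.\<close>

lemma mult_tensor_derivation_monom:
  assumes g: "alg_hom g" and D: "qlinear D" "D 1 = 0" "D Y = 0"
    "D X = pure_tensor ([X] @ ws @ [Y])"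
    "\<And>p q. D (p * q) = ract (D p) (g q) + lact (g p) (D q)"
  shows "mult_tensor (ract (lact a (D (monom w))) b) =
    (\<Sum>i<length w. if w ! i = Lx
      then X * g (monom (drop (Suc i) w)) * b * prod_list ws * a * g (monom (take i w)) * Y else 0)"
proof (induction w arbitrary: a b)
  case Nil
  have "D (monom []) = 0" using D(2) by (simp flip: one_monom)
  then show ?case
    by (simp add: qlinear_zero[OF qlinear_lact(2)] qlinear_zero[OF qlinear_ract(1)] mult_tensor_def
        qlinear_zero[OF qlinear_lin_ext])
next
  case (Cons l w)
  let ?L = "case l of Lx \<Rightarrow> X | Ly \<Rightarrow> Y"
  have L: "?L = monom [l]" by (cases l) (simp_all add: X_def Y_def)
  have gl: "g (monom (l # v)) = g ?L * g (monom v)" for v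
    by (simp add: monom_Cons alg_hom_simps(5)[OF g])
  \<comment> \<open>The tail of the word joins \<open>b\<close> in the term of the first letter; the
    first letter joins \<open>a\<close> in the remaining terms.\<close>
  have split: "mult_tensor (ract (lact a (D (monom (l # w)))) b) =
      mult_tensor (ract (lact a (D ?L)) (g (monom w) * b))
        + mult_tensor (ract (lact (a * g ?L) (D (monom w))) b)"
    unfolding monom_Cons D(5)
    by (simp add: qlinear_add[OF qlinear_lact(2)] qlinear_add[OF qlinear_ract(1)] lact_lact
        ract_ract lact_ract mult_tensor_def lin_ext_add)
  have "mult_tensor (ract (lact a (D ?L)) (g (monom w) * b)) =
      (if l = Lx then X * g (monom w) * b * prod_list ws * a * Y else 0)"
  proof (cases l)
    case Lx
    have "lact a (D X) = pure_tensor (X # ws @ [a * Y])"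
      unfolding D(4) using lact_pure[of a "X # ws" Y] by simp
    then show ?thesis using Lx
      by (simp add: ract_pure mult_tensor_pure mult.assoc)
  next
    case Ly
    then show ?thesis
      by (simp add: D(3) qlinear_zero[OF qlinear_lact(2)] qlinear_zero[OF qlinear_ract(1)]
          mult_tensor_def qlinear_zero[OF qlinear_lin_ext])
  qed
  then show ?case
    unfolding split Cons.IH
    by (simp add: sum.lessThan_Suc_shift gl alg_hom_simps(4)[OF g] mult.assoc
        del: sum.lessThan_Suc cong: if_cong)
qed

text \<open>Summing over positions keeps multiplicities for periodic words; a word without x gives
  zero.\<close>

definition cyclic_sum :: "letter list \<Rightarrow> ncpoly"
  where "cyclic_sum w = (\<Sum>i<length w. if w ! i = Lx then monom (rotate i w) else 0)"

text \<open>The padding stands for the inner tensor factors, whose product is \<open>Y ^ n\<close>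
  for \<open>C_bar\<close> and \<open>Z ^ n\<close>, that is \<open>gamma (Y ^ n)\<close>, for
  \<open>C\<close>.\<close>

definition pad_cyclic_sum :: "nat \<Rightarrow> ncpoly \<Rightarrow> ncpoly"
  where "pad_cyclic_sum n = lin_ext (\<lambda>v. cyclic_sum (v @ replicate n Ly))"

lemma qlinear_pad: "qlinear (pad_cyclic_sum n)"
  by (simp add: pad_cyclic_sum_def)

lemma cyclic_sum_append:
  "cyclic_sum (v @ replicate n Ly) =
    (\<Sum>i<length v. if v ! i = Lx
      then X * monom (drop (Suc i) v) * Y ^ n * monom (take i v) else 0)"
proof -
  let ?w = "v @ replicate n Ly"
  \<comment> \<open>The padded positions hold y and contribute nothing.\<close>
  have "cyclic_sum ?w = (\<Sum>i<length v. if ?w ! i = Lx then monom (rotate i ?w) else 0)"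
    unfolding cyclic_sum_def
    by (rule sum.mono_neutral_right) (auto simp: nth_append)
  also have "\<dots> = (\<Sum>i<length v. if v ! i = Lx
      then X * monom (drop (Suc i) v) * Y ^ n * monom (take i v) else 0)"
  proof (intro sum.cong refl)
    fix i assume "i \<in> {..<length v}"
    then have i: "i < length v" by simp
    then have "rotate i ?w = v ! i # drop (Suc i) v @ replicate n Ly @ take i v"
      by (simp add: rotate_drop_take Cons_nth_drop_Suc)
    with i show "(if ?w ! i = Lx then monom (rotate i ?w) else 0) =
       (if v ! i = Lx then X * monom (drop (Suc i) v) * Y ^ n * monom (take i v) else 0)"
      by (simp add: nth_append X_def Y_power monom_mult)
  qed
  finally show ?thesis .
qed

lemma qlinear_mult_tensor: "qlinear mult_tensor"
  by (simp add: mult_tensor_def)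

text \<open>The twist by \<open>inv gamma\<close> cancels against \<open>gamma\<close>, so the
  pulled-back derivation obeys the Leibniz rule with trivial twist.\<close>

lemma rho_bar_gamma: "rho_bar n (gamma p) = pad_cyclic_sum n p * Y"
proof (rule qlinear_eqI[of "\<lambda>p. rho_bar n (gamma p)" "\<lambda>p. pad_cyclic_sum n p * Y"])
  note C = C_bar_spec[of n, unfolded twisted_derivation_def]
  have l: "qlinear (\<lambda>p. C_bar n (gamma p))"
    using C by (intro qlinear_compose[OF _ alg_hom_simps(1)[OF alg_hom_gamma]]) simp
  show "qlinear (\<lambda>p. rho_bar n (gamma p))"
    using qlinear_compose[OF qlinear_mult_tensor l] by (simp add: rho_bar_def)
  show "qlinear (\<lambda>p. pad_cyclic_sum n p * Y)"
    by (rule qlinear_compose[OF qlinear_mult_left qlinear_pad])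
  fix w
  have "mult_tensor (ract (lact 1 (C_bar n (gamma (monom w)))) 1) =
    (\<Sum>i<length w. if w ! i = Lx
      then X * monom (drop (Suc i) w) * 1 * prod_list (replicate n Y) * 1 * monom (take i w) * Y else 0)"
  proof (rule mult_tensor_derivation_monom[of "\<lambda>p. p" "\<lambda>p. C_bar n (gamma p)"])
    show "C_bar n (gamma (p * q)) = ract (C_bar n (gamma p)) q + lact p (C_bar n (gamma q))" for p q
      using C by (simp add: alg_hom_simps(5)[OF alg_hom_gamma] inv_gamma gamma_subst)
    \<comment> \<open>As \<open>gamma Y = X + Y\<close>, the opposite values on the two letters
      cancel.\<close>
    show "C_bar n (gamma Y) = 0"
      using C qlinear_add[of "C_bar n" X Y] by (simp add: gamma_gens Z_def)
  qed (use C l in \<open>simp_all add: alg_hom_id alg_hom_simps(3)[OF alg_hom_gamma] gamma_gens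
      replicate_append_same\<close>)
  then show "rho_bar n (gamma (monom w)) = pad_cyclic_sum n (monom w) * Y"
    by (simp add: lact_one ract_one rho_bar_def pad_cyclic_sum_def cyclic_sum_append sum_distrib_right
        prod_list_replicate if_distrib[of "\<lambda>p. p * Y"] cong: if_cong)
qed

text \<open>Here the pullback has twist \<open>gamma\<close>. As \<open>gamma\<close> is
  multiplicative, fixes x and sends y to z, it comes out of every factor except the final
  \<open>Y\<close>.\<close>

lemma rho_gamma: "rho n (gamma p) = gamma (pad_cyclic_sum n p) * Y"
proof (rule qlinear_eqI[of "\<lambda>p. rho n (gamma p)" "\<lambda>p. gamma (pad_cyclic_sum n p) * Y"])
  note C = C_spec[of n, unfolded twisted_derivation_def]
  note h = alg_hom_simps[OF alg_hom_gamma]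
  have l: "qlinear (\<lambda>p. C n (gamma p))"
    using C by (intro qlinear_compose[OF _ h(1)]) simp
  show "qlinear (\<lambda>p. rho n (gamma p))"
    using qlinear_compose[OF qlinear_mult_tensor l] by (simp add: rho_def)
  show "qlinear (\<lambda>p. gamma (pad_cyclic_sum n p) * Y)"
    by (rule qlinear_compose[OF qlinear_mult_left qlinear_compose[OF h(1) qlinear_pad]])
  fix w
  have "mult_tensor (ract (lact 1 (C n (gamma (monom w)))) 1) =
    (\<Sum>i<length w. if w ! i = Lx
      then X * gamma (monom (drop (Suc i) w)) * 1 * prod_list (replicate n Z) * 1 * gamma (monom (take i w)) * Y else 0)"
  proof (rule mult_tensor_derivation_monom[of gamma "\<lambda>p. C n (gamma p)"])
    show "C n (gamma (p * q)) = ract (C n (gamma p)) (gamma q) + lact (gamma p) (C n (gamma q))" for p q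
      using C by (simp add: h(5))
    show "C n (gamma Y) = 0"
      using C qlinear_add[of "C n" X Y] by (simp add: gamma_gens Z_def)
  qed (use C l in \<open>simp_all add: alg_hom_gamma h(3) gamma_gens\<close>)
  then show "rho n (gamma (monom w)) = gamma (pad_cyclic_sum n (monom w)) * Y"
    by (simp add: lact_one ract_one rho_def pad_cyclic_sum_def cyclic_sum_append sum_distrib_right
        prod_list_replicate if_distrib[of "\<lambda>p. p * Y"] if_distrib[of gamma] h gamma_gens
        cong: if_cong)
qed

section \<open>The space \<open>H1_check\<close> and its preimage under \<open>gamma\<close>\<close>

definition words_x :: "nat \<Rightarrow> letter list set"
  where "words_x j = {w. length w = j \<and> Lx \<in> set w}"

lemma span_monom: "qvs.span (monom ` S) = {p. Poly_Mapping.keys p \<subseteq> S}"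
proof (intro equalityI subsetI)
  have "qvs.subspace {p :: 'a \<Rightarrow>\<^sub>0 rat. Poly_Mapping.keys p \<subseteq> S}"
    by (auto simp: qvs.subspace_def in_keys_iff lookup_add subset_iff) (metis add_0)
  moreover have "monom ` S \<subseteq> {p. Poly_Mapping.keys p \<subseteq> S}" by auto
  ultimately show "p \<in> {p. Poly_Mapping.keys p \<subseteq> S}" if "p \<in> qvs.span (monom ` S)" for p
    using that qvs.span_minimal by blast
  fix p :: "'a \<Rightarrow>\<^sub>0 rat" assume "p \<in> {p. Poly_Mapping.keys p \<subseteq> S}"
  then have "lin_ext monom p \<in> qvs.span (monom ` S)"
    by (intro lin_ext_in_subspace) (auto intro: qvs.span_base)
  then show "p \<in> qvs.span (monom ` S)" by (simp add: lin_ext_monom_id)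
qed

text \<open>Each x is kept and each y becomes a combination of single letters.\<close>

lemma keys_alg_hom_monom:
  assumes f: "alg_hom f" "f X = X" "Poly_Mapping.keys (f Y) \<subseteq> {[Lx], [Ly]}"
    and "u \<in> Poly_Mapping.keys (f (monom w))"
  shows "length u = length w \<and> (Lx \<in> set w \<longrightarrow> Lx \<in> set u)"
  using assms(4)
proof (induction w arbitrary: u)
  case Nil
  then show ?case by (simp add: alg_hom_simps[OF f(1)] zero_list_def)
next
  case (Cons l w)
  let ?L = "case l of Lx \<Rightarrow> X | Ly \<Rightarrow> Y"
  have "f (monom (l # w)) = f ?L * f (monom w)"
    by (simp add: monom_Cons alg_hom_simps(5)[OF f(1)])
  then obtain a b where u: "u = a @ b" "a \<in> Poly_Mapping.keys (f ?L)"
    "b \<in> Poly_Mapping.keys (f (monom w))"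
    using Cons.prems keys_mult[of "f ?L" "f (monom w)"] by (auto simp: plus_list_def)
  moreover have "a = [Lx]" if "l = Lx" using that u(2) f(2) by (simp add: X_def)
  moreover have "length a = 1" using u(2) f by (cases l) (auto simp: X_def)
  ultimately show ?case using Cons.IH[OF u(3)] by (cases l) auto
qed

lemma alg_hom_span_words_x:
  assumes f: "alg_hom f" "f X = X" "Poly_Mapping.keys (f Y) \<subseteq> {[Lx], [Ly]}"
  shows "f ` qvs.span (monom ` words_x j) \<subseteq> qvs.span (monom ` words_x j)"
proof
  fix q assume "q \<in> f ` qvs.span (monom ` words_x j)"
  then obtain p where p: "q = f p" "Poly_Mapping.keys p \<subseteq> words_x j"
    by (auto simp: span_monom)
  have "f (monom w) \<in> qvs.span (monom ` words_x j)" if "w \<in> words_x j" for w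
    unfolding span_monom using keys_alg_hom_monom[OF f, of _ w] that by (auto simp: words_x_def)
  then have "lin_ext (\<lambda>w. f (monom w)) p \<in> qvs.span (monom ` words_x j)"
    using p(2) by (intro lin_ext_in_subspace) auto
  then show "q \<in> qvs.span (monom ` words_x j)"
    using qlinear_expand[OF alg_hom_simps(1)[OF f(1)], of p] p(1) by simp
qed

text \<open>Both \<open>gamma\<close> and its inverse map the span into itself.\<close>

lemma gamma_span_words_x:
  "gamma ` qvs.span (monom ` words_x j) = qvs.span (monom ` words_x j)"
proof -
  have gens: "Poly_Mapping.keys Z \<subseteq> {[Lx], [Ly]}" "Poly_Mapping.keys (Y - X) \<subseteq> {[Lx], [Ly]}"
    by (auto simp: Z_def X_def Y_def in_keys_iff lookup_add lookup_minus lookup_single when_def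
        split: if_splits)
  have "gamma ` qvs.span (monom ` words_x j) \<subseteq> qvs.span (monom ` words_x j)"
    "subst_hom X (Y - X) ` qvs.span (monom ` words_x j) \<subseteq> qvs.span (monom ` words_x j)"
    using gens by (intro alg_hom_span_words_x; simp add: alg_hom_gamma alg_hom_subst gamma_gens subst_hom_gens)+
  moreover have "gamma ` subst_hom X (Y - X) ` A = A" for A
    by (simp add: image_image gamma_subst)
  ultimately show ?thesis by (metis image_mono subset_antisym)
qed

definition zword :: "nat \<Rightarrow> letter list"
  where "zword k = replicate (k - 1) Lx @ [Ly]"

lemma prod_zmon: "prod_list (map zmon ks) = monom (concat (map zword ks))"
  by (induction ks) (simp_all add: one_monom zmon_def zword_def X_power Y_def monom_mult)

lemma length_concat_zword:
  "\<forall>i\<in>set ks. i \<ge> 1 \<Longrightarrow> length (concat (map zword ks)) = sum_list ks"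
  by (induction ks) (auto simp: zword_def)

lemma Lx_in_concat_zword:
  "\<forall>i\<in>set ks. i \<ge> 1 \<Longrightarrow> Lx \<in> set (concat (map zword ks)) \<longleftrightarrow> \<not> (\<forall>i\<in>set ks. i = 1)"
  by (induction ks) (auto simp: zword_def)

text \<open>Reading from the right, a new x raises the first index by one and a new y starts a block
  of index 1.\<close>

lemma ex_concat_zword: "\<exists>ks. (\<forall>i\<in>set ks. i \<ge> 1) \<and> concat (map zword ks) = w @ [Ly]"
proof (induction w)
  case Nil
  then show ?case by (intro exI[of _ "[1]"]) (simp add: zword_def)
next
  case (Cons l w)
  then obtain ks where ks: "\<forall>i\<in>set ks. i \<ge> 1" "concat (map zword ks) = w @ [Ly]" by blast
  show ?case
  proof (cases l)
    case Lx
    obtain i ks' where i: "ks = i # ks'" using ks(2) by (cases ks) auto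
    with ks(1) have "zword (Suc i) = Lx # zword i" by (cases i) (auto simp: zword_def)
    with ks Lx i show ?thesis by (intro exI[of _ "Suc i # ks'"]) auto
  next
    case Ly
    have "zword 1 = [Ly]" by (simp add: zword_def)
    with ks Ly show ?thesis by (intro exI[of _ "1 # ks"]) auto
  qed
qed

text \<open>Nonempty products of the \<open>zmon\<close> are the words ending in y; an index above 1
  means that an x occurs before that final y.\<close>

lemma H1_check_Suc: "H1_check (Suc j) = (\<lambda>p. p * Y) ` qvs.span (monom ` words_x j)"
proof -
  interpret Vector_Spaces.linear scale scale "\<lambda>p :: ncpoly. p * Y"
    by (rule qlinear_mult_left)
  have "{prod_list (map zmon ks) | ks. length ks \<ge> 1 \<and> (\<forall>i\<in>set ks. i \<ge> 1) \<and> sum_list ks = Suc j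
      \<and> \<not> (\<forall>i\<in>set ks. i = 1)} = (\<lambda>w. monom (w @ [Ly])) ` words_x j" (is "?A = ?B")
  proof (intro equalityI subsetI)
    fix p assume "p \<in> ?A"
    then obtain ks where ks: "p = prod_list (map zmon ks)" "length ks \<ge> 1" "\<forall>i\<in>set ks. i \<ge> 1"
      "sum_list ks = Suc j" "\<not> (\<forall>i\<in>set ks. i = 1)" by blast
    let ?c = "concat (map zword ks)"
    obtain w where w: "?c = w @ [Ly]"
      using ks(2) by (cases ks rule: rev_cases) (auto simp: zword_def)
    with length_concat_zword[OF ks(3)] Lx_in_concat_zword[OF ks(3)] ks(4,5)
    have "w \<in> words_x j" by (auto simp: words_x_def)
    with w ks(1) show "p \<in> ?B" by (auto simp: prod_zmon)
  next
    fix p assume "p \<in> ?B"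
    then obtain w where w: "w \<in> words_x j" "p = monom (w @ [Ly])" by blast
    obtain ks where ks: "\<forall>i\<in>set ks. i \<ge> 1" "concat (map zword ks) = w @ [Ly]"
      using ex_concat_zword by blast
    with length_concat_zword[OF ks(1)] Lx_in_concat_zword[OF ks(1)] w(1)
    have "sum_list ks = Suc j" "\<not> (\<forall>i\<in>set ks. i = 1)" by (auto simp: words_x_def)
    moreover from this have "length ks \<ge> 1" by (cases ks) auto
    ultimately show "p \<in> ?A" using ks w(2) by (auto simp: prod_zmon intro!: exI[of _ ks])
  qed
  also have "\<dots> = (\<lambda>p. p * Y) ` monom ` words_x j"
    by (simp add: image_image Y_def monom_mult)
  finally show ?thesis unfolding H1_check_def by (simp add: span_image)
qed

text \<open>Right multiplication by \<open>Y\<close> pulls back to right multiplication by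
  \<open>Y - X\<close>, and \<open>gamma\<close> preserves the span.\<close>

lemma H1_check_gamma:
  "H1_check (Suc j) = gamma ` (\<lambda>p. p * (Y - X)) ` qvs.span (monom ` words_x j)"
proof -
  have "gamma (p * (Y - X)) = gamma p * Y" for p
    by (simp add: alg_hom_simps(5)[OF alg_hom_gamma] alg_hom_diff[OF alg_hom_gamma] gamma_gens, simp add: Z_def)
  then show ?thesis
    unfolding H1_check_Suc by (subst gamma_span_words_x[symmetric]) (simp add: image_image)
qed

text \<open>The edges of the necklace graph: the values of \<open>pad_cyclic_sum n\<close> on the
  generators \<open>monom w * (Y - X)\<close>.\<close>

definition flips :: "nat \<Rightarrow> nat \<Rightarrow> ncpoly set"
  where "flips n j = (\<lambda>w. cyclic_sum (w @ Ly # replicate n Ly) - cyclic_sum (w @ Lx # replicate n Ly))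
    ` words_x j"

lemma pad_cyclic_sum_image:
  "pad_cyclic_sum n ` (\<lambda>p. p * (Y - X)) ` qvs.span (monom ` words_x j) = qvs.span (flips n j)"
proof -
  have l: "qlinear (\<lambda>p. pad_cyclic_sum n (p * (Y - X)))"
    by (rule qlinear_compose[OF qlinear_pad qlinear_mult_left])
  interpret Vector_Spaces.linear scale scale "\<lambda>p. pad_cyclic_sum n (p * (Y - X))" by fact
  interpret pad: Vector_Spaces.linear scale scale "pad_cyclic_sum n" by (rule qlinear_pad)
  have "pad_cyclic_sum n (monom w * (Y - X)) =
      cyclic_sum (w @ Ly # replicate n Ly) - cyclic_sum (w @ Lx # replicate n Ly)" for w
    by (simp add: right_diff_distrib pad.diff X_def Y_def monom_mult) (simp add: pad_cyclic_sum_def)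
  then show ?thesis
    by (simp add: image_image flips_def flip: span_image)
qed

lemma inj_mult_Y: "inj (\<lambda>p. p * Y)"
proof (rule inj_on_inverseI)
  show "lin_ext (\<lambda>u. monom (butlast u)) (p * Y) = p" for p :: ncpoly
    by (rule qlinear_eqI[OF qlinear_compose[OF qlinear_lin_ext qlinear_mult_left] qlinear_id])
      (simp add: Y_def monom_mult)
qed

lemma dim_rho_image:
  assumes "qvs.independent B" "qvs.span B = qvs.span (flips n j)"
  shows "qvs.dim (rho_bar n ` H1_check (Suc j)) = card B" "qvs.dim (rho n ` H1_check (Suc j)) = card B"
proof -
  have "rho_bar n ` H1_check (Suc j) = (\<lambda>p. p * Y) ` qvs.span B"
    unfolding assms(2) pad_cyclic_sum_image[symmetric] H1_check_gamma
    by (simp add: image_image rho_bar_gamma)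
  then show "qvs.dim (rho_bar n ` H1_check (Suc j)) = card B"
    using dim_image_independent[OF qlinear_mult_left inj_mult_Y assms(1)] by simp
  have "rho n ` H1_check (Suc j) = (\<lambda>p. gamma p * Y) ` qvs.span B"
    unfolding assms(2) pad_cyclic_sum_image[symmetric] H1_check_gamma
    by (simp add: image_image rho_gamma)
  moreover have "inj (\<lambda>p. gamma p * Y)"
    using inj_compose[OF inj_mult_Y bij_is_inj[OF bij_gamma]] by (simp add: o_def)
  ultimately show "qvs.dim (rho n ` H1_check (Suc j)) = card B"
    using dim_image_independent[OF qlinear_compose[OF qlinear_mult_left
        alg_hom_simps(1)[OF alg_hom_gamma]] _ assms(1)] by simp
qed

subsection \<open>The dimension of the span of cyclic sums\<close>

lemma cyclic_sum_rotate: "cyclic_sum (rotate i w) = cyclic_sum w"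
proof -
  have step: "cyclic_sum (rotate1 w) = cyclic_sum w" for w
  proof (cases "w = []")
    case False
    then obtain m where m: "length w = Suc m" by (cases w) auto
    define h where "h i = (if w ! i = Lx then monom (rotate i w) else 0)" for i
    have rot: "rotate i (rotate1 w) = rotate (Suc i mod Suc m) w" for i
      using rotate_conv_mod[of "Suc i" w] m by (simp add: rotate1_rotate_swap)
    \<comment> \<open>Rotation by one only permutes the summands cyclically.\<close>
    have "cyclic_sum (rotate1 w) = (\<Sum>i<Suc m. h (Suc i mod Suc m))"
      unfolding cyclic_sum_def h_def by (intro sum.cong) (auto simp: m rot nth_rotate1)
    also have "\<dots> = (\<Sum>i<m. h (Suc i)) + h 0" by simp
    also have "\<dots> = (\<Sum>i<Suc m. h i)"
      unfolding sum.lessThan_Suc_shift by (simp add: add.commute)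
    finally show ?thesis by (simp add: cyclic_sum_def h_def m)
  qed simp
  show ?thesis by (induction i) (simp_all add: step)
qed

lemma cyclic_sum_orbit: "orbit u = orbit w \<Longrightarrow> cyclic_sum u = cyclic_sum w"
  unfolding orbit_eq_iff by (auto simp: orbit_def cyclic_sum_rotate)

text \<open>The coefficient is a number of positions, so nothing cancels.\<close>

lemma lookup_cyclic_sum:
  assumes "w \<noteq> []"
  shows "Poly_Mapping.lookup (cyclic_sum w) u \<noteq> 0 \<longleftrightarrow> u \<in> orbit w \<and> hd u = Lx"
proof -
  have "Poly_Mapping.lookup (cyclic_sum w) u =
      (\<Sum>i<length w. if w ! i = Lx \<and> rotate i w = u then 1 else 0)"
    unfolding cyclic_sum_def lookup_sum
    by (intro sum.cong) (auto simp: lookup_single when_def)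
  also have "\<dots> = of_nat (card {i\<in>{..<length w}. w ! i = Lx \<and> rotate i w = u})"
    by (simp add: sum.If_cases Int_def)
  finally have "Poly_Mapping.lookup (cyclic_sum w) u \<noteq> 0 \<longleftrightarrow>
      (\<exists>i<length w. w ! i = Lx \<and> rotate i w = u)" by auto
  also have "\<dots> \<longleftrightarrow> u \<in> orbit w \<and> hd u = Lx"
  proof
    assume "u \<in> orbit w \<and> hd u = Lx"
    then obtain i where "u = rotate i w" "hd u = Lx" by (auto simp: orbit_def)
    with assms show "\<exists>i<length w. w ! i = Lx \<and> rotate i w = u"
      by (intro exI[of _ "i mod length w"])
        (auto simp: hd_rotate_conv_nth simp flip: rotate_conv_mod)
  qed (use assms in \<open>auto simp: hd_rotate_conv_nth rotate_in_orbit\<close>)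
  finally show ?thesis .
qed

lemma count_list_rotate: "count_list (rotate i w) x = count_list w x"
proof -
  have "count_list (rotate1 w) x = count_list w x" for w
    by (cases w) simp_all
  then show ?thesis by (induction i) simp_all
qed

lemma eq_replicate_Ly: "Lx \<notin> set w \<Longrightarrow> w = replicate (length w) Ly"
  by (induction w) (auto, metis letter.exhaust)

lemma cyclic_run_append: "cyclic_run n (v @ replicate n Ly)"
  unfolding cyclic_run_def by (intro exI[of _ "length v"]) (auto simp: nth_append)

text \<open>The run is rotated to the end of the word; any further letters y between the last x and
  the run are then rotated to the front. The count of x serves as induction measure later.\<close>

lemma cyclic_run_normal_form:
  assumes w: "length w = n + Suc j" "cyclic_run n w" "Lx \<in> set w"
  obtains u where "length u = j" "orbit w = orbit (u @ Lx # replicate n Ly)"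
    "count_list w Lx = Suc (count_list u Lx)"
proof -
  from w(2) obtain s where s: "\<And>i. i < n \<Longrightarrow> w ! ((s + i) mod length w) = Ly"
    by (auto simp: cyclic_run_def)
  \<comment> \<open>Position \<open>s + n\<close> is the first one after the window, so rotating
    there puts the window last.\<close>
  define v where "v = take (Suc j) (rotate (s + n) w)"
  have "drop (Suc j) (rotate (s + n) w) = replicate n Ly"
  proof (rule nth_equalityI)
    fix i assume "i < length (drop (Suc j) (rotate (s + n) w))"
    then have i: "i < n" using w(1) by simp
    have "rotate (s + n) w ! (Suc j + i) = w ! ((s + n + (Suc j + i)) mod length w)"
      using w(1) i by (intro nth_rotate) simp
    also have "s + n + (Suc j + i) = (s + i) + length w" using w(1) by simp
    finally have "rotate (s + n) w ! (Suc j + i) = Ly" using s[OF i] by (simp only: mod_add_self2)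
    then show "drop (Suc j) (rotate (s + n) w) ! i = replicate n Ly ! i"
      using i w(1) by simp
  qed (use w(1) in simp)
  then have rot: "rotate (s + n) w = v @ replicate n Ly"
    unfolding v_def by (metis append_take_drop_id)
  then have "Lx \<in> set v" using w(3) set_rotate[of "s + n" w] by auto
  then obtain v' zs where v: "v = v' @ Lx # zs" "Lx \<notin> set zs"
    using split_list_last by fastforce
  define u where "u = zs @ v'"
  have zs: "zs = replicate (length zs) Ly" using v(2) by (rule eq_replicate_Ly)
  \<comment> \<open>\<open>zs\<close> consists of letters y and so can trade places with the
    padding.\<close>
  have rot': "rotate (s + n) w = (v' @ Lx # replicate n Ly) @ zs"
    unfolding rot v(1) by (subst zs, subst (2) zs) (simp flip: replicate_add add: add.commute)
  have "rotate (length (v' @ Lx # replicate n Ly)) (rotate (s + n) w) = u @ Lx # replicate n Ly"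
    unfolding rot' rotate_append by (simp add: u_def)
  then obtain i where i: "rotate i w = u @ Lx # replicate n Ly"
    by (metis rotate_rotate)
  show thesis
  proof
    show "length u = j" using arg_cong[OF i, of length] w(1) by simp
    show "orbit w = orbit (u @ Lx # replicate n Ly)"
      using orbit_rotate[of i w] i by simp
    show "count_list w Lx = Suc (count_list u Lx)"
      using count_list_rotate[of i w Lx] i by simp
  qed
qed

section \<open>Connecting necklaces by turning x into y\<close>

definition single_x :: "nat \<Rightarrow> letter list"
  where "single_x m = Lx # replicate m Ly"

text \<open>In normal form the x before the run can be turned into y along an edge as long as
  another x remains; this lowers the number of x until only one is left.\<close>

lemma cyclic_sum_connected:
  assumes "length w = n + Suc j" "cyclic_run n w" "Lx \<in> set w"
  shows "cyclic_sum w - cyclic_sum (single_x (n + j)) \<in> qvs.span (flips n j)"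
  using assms
proof (induction "count_list w Lx" arbitrary: w rule: less_induct)
  case less
  obtain u where u: "length u = j" "orbit w = orbit (u @ Lx # replicate n Ly)"
    "count_list w Lx = Suc (count_list u Lx)"
    by (rule cyclic_run_normal_form[OF less.prems])
  let ?x = "u @ Lx # replicate n Ly" and ?y = "u @ Ly # replicate n Ly"
  have w: "cyclic_sum w = cyclic_sum ?x" by (rule cyclic_sum_orbit[OF u(2)])
  show ?case
  proof (cases "Lx \<in> set u")
    case True
    have "cyclic_sum ?y - cyclic_sum (single_x (n + j)) \<in> qvs.span (flips n j)"
      using u True cyclic_run_append[of n "u @ [Ly]"] by (intro less.hyps) auto
    moreover have "cyclic_sum ?y - cyclic_sum ?x \<in> qvs.span (flips n j)"
      using u(1) True by (intro qvs.span_base) (auto simp: flips_def words_x_def)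
    ultimately have "cyclic_sum ?y - cyclic_sum (single_x (n + j)) - (cyclic_sum ?y - cyclic_sum ?x)
        \<in> qvs.span (flips n j)" by (rule qvs.span_diff)
    then show ?thesis by (simp add: w)
  next
    case False
    \<comment> \<open>With its only x before the run, the word is a rotation of the base
      word.\<close>
    then have "u = replicate j Ly" using eq_replicate_Ly u(1) by blast
    then have "rotate (length u) ?x = single_x (n + j)"
      unfolding rotate_append by (simp add: single_x_def replicate_add)
    then have "cyclic_sum ?x = cyclic_sum (single_x (n + j))" by (metis cyclic_sum_rotate)
    then show ?thesis by (simp add: w qvs.span_zero)
  qed
qed

text \<open>The basis consists of the differences to the base word \<open>single_x (n + j)\<close>,
  one for each other necklace with a run and an x. The two necklaces left out are the base word and
  the word without x.\<close>

lemma flips_basis: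
  obtains B where "qvs.independent B" "qvs.span B = qvs.span (flips n j)"
    "card B + 2 = card (orbit ` {w. length w = n + Suc j \<and> cyclic_run n w})"
proof -
  define N where "N = n + Suc j"
  define S where "S = {w. length w = N \<and> cyclic_run n w}"
  define e where "e = cyclic_sum (single_x (n + j))"
  define I where "I = orbit ` S - {orbit (replicate N Ly), orbit (single_x (n + j))}"
  \<comment> \<open>A word starting with x lies in the support of the cyclic sum of its own necklace
    and of no other, so it serves as test coordinate.\<close>
  define rep where "rep c = (SOME u. orbit u = c \<and> hd u = Lx)" for c
  define f where "f c = cyclic_sum (rep c) - e" for c
  have finS: "finite S" unfolding S_def by (rule finite_words)
  have rep: "orbit (rep (orbit w)) = orbit w \<and> hd (rep (orbit w)) = Lx" if "Lx \<in> set w" for w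
  proof -
    obtain ys zs where "w = ys @ Lx # zs" using \<open>Lx \<in> set w\<close> split_list by fastforce
    then have "rotate (length ys) w = Lx # zs @ ys" by (simp add: rotate_append)
    then have "orbit (Lx # zs @ ys) = orbit w" by (metis orbit_rotate)
    then show ?thesis
      unfolding rep_def
      using someI[of "\<lambda>u. orbit u = orbit w \<and> hd u = Lx" "Lx # zs @ ys"] by simp
  qed
  have f_orbit: "f (orbit w) = cyclic_sum w - e" if "Lx \<in> set w" for w
    unfolding f_def using cyclic_sum_orbit[of "rep (orbit w)" w] rep[OF that] by simp
  have I_word: "\<exists>w\<in>S. c = orbit w \<and> Lx \<in> set w" if c: "c \<in> I" for c
  proof -
    obtain w where w: "w \<in> S" "c = orbit w" using c by (auto simp: I_def)
    moreover have "w \<noteq> replicate N Ly" using c w(2) by (auto simp: I_def)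
    ultimately show ?thesis using eq_replicate_Ly[of w] by (auto simp: S_def)
  qed
  have rep_I: "orbit (rep c) = c \<and> hd (rep c) = Lx" if "c \<in> I" for c
    using I_word[OF that] rep by blast
  have test: "Poly_Mapping.lookup (f c) (rep d) \<noteq> 0 \<longleftrightarrow> c = d" if cd: "c \<in> I" "d \<in> I" for c d
  proof -
    have c: "orbit (rep c) = c" "orbit (rep d) = d" "hd (rep d) = Lx"
      using rep_I cd by simp_all
    \<comment> \<open>The base necklace is not in \<open>I\<close>, so \<open>e\<close> vanishes at
      every test coordinate.\<close>
    have "rep d \<notin> orbit (single_x (n + j))"
      unfolding orbit_eq_iff[symmetric] c(2) using cd(2) by (simp add: I_def)
    then have "Poly_Mapping.lookup e (rep d) = 0"
      unfolding e_def using lookup_cyclic_sum[of "single_x (n + j)" "rep d"]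
      by (auto simp: single_x_def)
    moreover have "rep c \<noteq> []"
    proof
      assume "rep c = []"
      with c(1) have "c = {[]}" by (simp add: orbit_def)
      moreover obtain w where "w \<in> S" "c = orbit w" using I_word[OF cd(1)] by blast
      ultimately show False using orbit_refl[of w] by (simp add: S_def N_def)
    qed
    ultimately have "Poly_Mapping.lookup (f c) (rep d) \<noteq> 0 \<longleftrightarrow> rep d \<in> orbit (rep c)"
      using lookup_cyclic_sum[of "rep c" "rep d"] c(3) by (simp add: f_def lookup_minus)
    also have "\<dots> \<longleftrightarrow> orbit (rep d) = orbit (rep c)" by (simp only: orbit_eq_iff)
    finally have "Poly_Mapping.lookup (f c) (rep d) \<noteq> 0 \<longleftrightarrow> d = c" unfolding c(1,2) .
    then show ?thesis by blast
  qed
  have finI: "finite I" using finS by (simp add: I_def)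
  have indep: "inj_on f I" "qvs.independent (f ` I)"
    by (rule independent_of_tests[of I f rep]; use finI test in blast)+
  have sub: "f ` I \<subseteq> qvs.span (flips n j)"
  proof
    fix p assume "p \<in> f ` I"
    then obtain w where "w \<in> S" "p = f (orbit w)" "Lx \<in> set w" using I_word by blast
    then show "p \<in> qvs.span (flips n j)"
      using cyclic_sum_connected[of w n j] f_orbit by (simp add: S_def N_def e_def)
  qed
  have in_span: "cyclic_sum w - e \<in> qvs.span (f ` I)" if "w \<in> S" "Lx \<in> set w" for w
  proof (cases "orbit w = orbit (single_x (n + j))")
    case True
    then have "cyclic_sum w = e" unfolding e_def by (rule cyclic_sum_orbit)
    then show ?thesis by (simp add: qvs.span_zero)
  next
    case False
    have "orbit w \<noteq> orbit (replicate N Ly)"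
    proof
      assume "orbit w = orbit (replicate N Ly)"
      then have "w \<in> orbit (replicate N Ly)" by (simp add: orbit_eq_iff)
      then have "set w \<subseteq> {Ly}" by (auto simp: orbit_def)
      with that(2) show False by auto
    qed
    with False that(1) have "f (orbit w) \<in> f ` I" by (auto simp: I_def)
    then show ?thesis using f_orbit[OF that(2)] by (simp add: qvs.span_base)
  qed
  have sub': "flips n j \<subseteq> qvs.span (f ` I)"
  proof
    fix p assume "p \<in> flips n j"
    then obtain w where w: "w \<in> words_x j" and p:
      "p = cyclic_sum (w @ Ly # replicate n Ly) - cyclic_sum (w @ Lx # replicate n Ly)"
      by (auto simp: flips_def)
    \<comment> \<open>Both ends of an edge have a run and an x from \<open>w\<close>; subtracting
      cancels \<open>e\<close>.\<close>
    have "cyclic_sum (w @ l # replicate n Ly) - e \<in> qvs.span (f ` I)" for l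
      using w cyclic_run_append[of n "w @ [l]"] by (intro in_span) (auto simp: S_def N_def words_x_def)
    from qvs.span_diff[OF this[of Ly] this[of Lx]] show "p \<in> qvs.span (f ` I)" by (simp add: p)
  qed
  have span: "qvs.span (f ` I) = qvs.span (flips n j)"
    using sub sub' by (simp add: qvs.span_eq)
  have ne: "orbit (replicate N Ly) \<noteq> orbit (single_x (n + j))"
  proof
    assume "orbit (replicate N Ly) = orbit (single_x (n + j))"
    then have "single_x (n + j) \<in> orbit (replicate N Ly)" by (metis orbit_refl)
    then have "set (single_x (n + j)) \<subseteq> {Ly}" by (auto simp: orbit_def)
    then show False by (simp add: single_x_def)
  qed
  have "single_x (n + j) = (Lx # replicate j Ly) @ replicate n Ly"
    by (simp add: single_x_def add.commute[of n] replicate_add)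
  then have "single_x (n + j) \<in> S" using cyclic_run_append[of n "Lx # replicate j Ly"]
    by (simp add: S_def N_def)
  moreover have "replicate N Ly \<in> S"
    unfolding S_def using cyclic_run_replicate[of N n] by (simp add: N_def)
  ultimately have two: "{orbit (replicate N Ly), orbit (single_x (n + j))} \<subseteq> orbit ` S" by auto
  have "card I = card (orbit ` S) - 2" "2 \<le> card (orbit ` S)"
    using card_Diff_subset[OF _ two] card_mono[OF finite_imageI[OF finS] two] ne
    unfolding I_def by simp_all
  moreover have "card (f ` I) = card I" by (rule card_image[OF indep(1)])
  ultimately have "card (f ` I) + 2 = card (orbit ` S)" by simp
  then show thesis
    unfolding S_def N_def by (rule that[OF indep(2) span])
qed

theorem theorem6p12:
  fixes n k :: nat
  assumes "k \<ge> 1"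
  shows "qvs.dim (rho_bar n ` H1_check k) = qvs.dim (rho n ` H1_check k)
    \<and> (of_nat (qvs.dim (rho n ` H1_check k)) :: rat) =
      1 / of_nat (n + k) *
        (\<Sum>m | m dvd n + k. of_nat (totient ((n + k) div m)) * (2 ^ m - of_int (lucas n m))) - 2"
proof -
  obtain j where k: "k = Suc j" using assms by (cases k) auto
  let ?Q = "orbit ` {w. length w = n + k \<and> cyclic_run n w}"
  obtain B where B: "qvs.independent B" "qvs.span B = qvs.span (flips n j)" "card B + 2 = card ?Q"
    using flips_basis[of n j] unfolding k by blast
  note dim = dim_rho_image[OF B(1,2), folded k]
  have "of_nat (n + k) * (of_nat (card ?Q) :: rat) =
      (\<Sum>m | m dvd n + k. of_nat (totient ((n + k) div m)) * (2 ^ m - of_int (lucas n m)))"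
  proof -
    have "of_nat (n + k) * (of_nat (card ?Q) :: rat) = of_nat ((n + k) * card ?Q)"
      by (simp only: of_nat_mult)
    also have "\<dots> = (\<Sum>m | m dvd n + k. of_nat (totient ((n + k) div m)) *
        of_nat (card {u. length u = m \<and> cyclic_run n u}))"
      using card_necklaces[of "n + k" n] assms by simp
    \<comment> \<open>Divisors of \<open>n + k\<close> are positive, so the Lucas count applies to
      each of them.\<close>
    also have "\<dots> = (\<Sum>m | m dvd n + k. of_nat (totient ((n + k) div m)) * (2 ^ m - of_int (lucas n m)))"
      using assms by (intro sum.cong refl) (auto simp: card_cyclic_run intro!: card_cyclic_run dest: dvd_pos_nat)
    finally show ?thesis .
  qed
  then have "1 / of_nat (n + k) * (\<Sum>m | m dvd n + k. of_nat (totient ((n + k) div m)) *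
      (2 ^ m - of_int (lucas n m))) = (of_nat (card ?Q) :: rat)"
    using assms by (simp add: field_simps)
  then show ?thesis
    unfolding dim B(3)[symmetric] by simp
qed

end
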